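(* Let $F$ be a forest. Then (1) the star ideal $F^\star$ is simple; (2) the dominance complex $R(F^\star)$ collapses onto (a subcomplex isomorphic to) the boundary of a cross-polytope of dimension $d(F^\star)$; (3) $\beta_1(F)=\alpha_0(F)=d(F^\star)$.
   Context: For a graph $G$ on vertices $X=\{x_1,\ldots,x_n\}$, the star ideal $G^\star\subset\mathbb{Z}[X]$ is generated by $x_1^2,\ldots,x_n^2$ and the monomials $\prod_{x\in N[x_i]}x$, $i=1,\ldots,n$, where $N[x_i]$ is the closed neighbourhood; $R(G^\star)$ is the dominance complex. $\beta_1$ is the matching number (maximum number of pairwise disjoint edges) and $\alpha_0$ the vertex covering number (minimum size of a set of vertices meeting every edge). For a monomial ideal $I$ containing all $x_i^2$: $R(I)$ is the simplicial complex of monomials not in $I$; $(I:x)=\{m:xm\in I\}$; $R(I)$ is a cone with apex $a$ if $(I:a)=(I,a)$; $a$ dominates $b$ in $I$ if $R(I)$ is not a cone with apex $b$ but $R((I,a))$ is. A sequence $(a_1,\ldots,a_r)$ of variables with $I_i=(I:a_1\cdots a_{i-1})$, $i\in[r+1]$, is a resolution if for all $i\in[r]$, $a_i\notin I_i$ and either $R(I_i)$ is a cone with apex $a_i$ or $a_i$ dominates some variable in $I_i$; maximal if not extendable; its core is $I_{r+1}$ and depth $r$; $d(I)$ is the minimum depth of a maximal resolution; $I$ is simple if $(x_1,\ldots,x_n)$ is the core of some maximal resolution (ideals being identified with their extensions by extra variables). An elementary collapse removes a maximal face $\sigma$ and a face $\tau\subset\sigma$ of one less degree such that $\sigma$ is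 the only face properly containing $\tau$; collapsing means a sequence of these. The boundary of the $d$-dimensional cross-polytope is $R\bigl((y_1y_2,\ldots,y_{2d-1}y_{2d},y_1^2,\ldots,y_{2d}^2)\bigr)$. *)

theory Defs
  imports "HOL-Algebra.Ideal" "HOL-Library.Poly_Mapping" "HOL-Library.Disjoint_Sets"
begin

text \<open>
  Monomials in variables from \<^typ>\<open>'a\<close> are exponent vectors (written additively), and integer
  polynomials are finitely supported functions from monomials to \<^typ>\<open>int\<close>. The type
  \<open>'a\<close> may contain more elements than the variables in play, so the ring
  \<open>\<int>[X]\<close> is given by an explicit carrier and a finite variable set \<open>X\<close>.
\<close>

type_synonym 'a mon = "'a \<Rightarrow>\<^sub>0 nat"
type_synonym 'a int_mpoly = "'a mon \<Rightarrow>\<^sub>0 int"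

definition mon_poly :: "'a mon \<Rightarrow> 'a int_mpoly" where
  "mon_poly m = Poly_Mapping.single m 1"

definition Var :: "'a \<Rightarrow> 'a int_mpoly" where
  "Var x = mon_poly (Poly_Mapping.single x 1)"

definition int_poly_ring :: "'a set \<Rightarrow> 'a int_mpoly ring" where
  "int_poly_ring X = \<lparr>carrier = {p. \<forall>m \<in> Poly_Mapping.keys p. Poly_Mapping.keys m \<subseteq> X},
           mult = (*), one = 1, zero = 0, add = (+)\<rparr>"

lemma int_poly_ring_add_closed:
  assumes "p \<in> carrier (int_poly_ring X)" "q \<in> carrier (int_poly_ring X)"
  shows "p + q \<in> carrier (int_poly_ring X)"
  using assms subsetD[OF keys_add[of p q]] unfolding int_poly_ring_def by auto

lemma int_poly_ring_mult_closed:
  assumes "p \<in> carrier (int_poly_ring X)" "q \<in> carrier (int_poly_ring X)"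
  shows "p * q \<in> carrier (int_poly_ring X)"
proof -
  have "Poly_Mapping.keys m \<subseteq> X" if m: "m \<in> Poly_Mapping.keys (p * q)" for m
  proof -
    obtain a b where "m = a + b" "a \<in> Poly_Mapping.keys p" "b \<in> Poly_Mapping.keys q"
      using subsetD[OF keys_mult m] by auto
    then show ?thesis
      using assms keys_add[of a b] unfolding int_poly_ring_def by simp blast
  qed
  then show ?thesis by (simp add: int_poly_ring_def)
qed

lemma cring_int_poly_ring: "cring (int_poly_ring X)"
proof (rule cringI)
  show "abelian_group (int_poly_ring X)"
  proof (rule abelian_groupI)
    fix p assume "p \<in> carrier (int_poly_ring X)"
    then show "\<exists>q \<in> carrier (int_poly_ring X). q \<oplus>\<^bsub>int_poly_ring X\<^esub> p = \<zero>\<^bsub>int_poly_ring X\<^esub>"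
      by (intro bexI[of _ "- p"]) (simp_all add: int_poly_ring_def)
  next
    fix p q assume "p \<in> carrier (int_poly_ring X)" "q \<in> carrier (int_poly_ring X)"
    from int_poly_ring_add_closed[OF this]
    show "p \<oplus>\<^bsub>int_poly_ring X\<^esub> q \<in> carrier (int_poly_ring X)"
      by (simp add: int_poly_ring_def)
  qed (simp_all add: int_poly_ring_def ac_simps)
  show "comm_monoid (int_poly_ring X)"
  proof (rule comm_monoidI)
    fix p q assume "p \<in> carrier (int_poly_ring X)" "q \<in> carrier (int_poly_ring X)"
    from int_poly_ring_mult_closed[OF this]
    show "p \<otimes>\<^bsub>int_poly_ring X\<^esub> q \<in> carrier (int_poly_ring X)"
      by (simp add: int_poly_ring_def)
  qed (simp_all add: int_poly_ring_def ac_simps)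
qed (simp add: int_poly_ring_def distrib_right)


definition mon_dvd :: "'a mon \<Rightarrow> 'a mon \<Rightarrow> bool" where
  "mon_dvd m n \<longleftrightarrow> (\<exists>k. n = m + k)"

definition mon_degree :: "'a mon \<Rightarrow> nat" where
  "mon_degree m = (\<Sum>x \<in> Poly_Mapping.keys m. Poly_Mapping.lookup m x)"

definition complex_of :: "'a set \<Rightarrow> 'a int_mpoly set \<Rightarrow> 'a mon set" where
  "complex_of X I = {m. Poly_Mapping.keys m \<subseteq> X \<and> mon_poly m \<notin> I}"

definition colon :: "'a set \<Rightarrow> 'a int_mpoly set \<Rightarrow> 'a int_mpoly \<Rightarrow> 'a int_mpoly set" where
  "colon X I p = {q \<in> carrier (int_poly_ring X). p * q \<in> I}"

definition adjoin :: "'a set \<Rightarrow> 'a int_mpoly set \<Rightarrow> 'a int_mpoly \<Rightarrow> 'a int_mpoly set" where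
  "adjoin X I p = Idl\<^bsub>int_poly_ring X\<^esub> (insert p I)"

definition is_cone :: "'a set \<Rightarrow> 'a int_mpoly set \<Rightarrow> 'a \<Rightarrow> bool" where
  "is_cone X I a \<longleftrightarrow> colon X I (Var a) = adjoin X I (Var a)"

definition dominates :: "'a set \<Rightarrow> 'a int_mpoly set \<Rightarrow> 'a \<Rightarrow> 'a \<Rightarrow> bool" where
  "dominates X I a b \<longleftrightarrow> \<not> is_cone X I b \<and> is_cone X (adjoin X I (Var a)) b"


definition colon_seq :: "'a set \<Rightarrow> 'a int_mpoly set \<Rightarrow> 'a list \<Rightarrow> 'a int_mpoly set" where
  "colon_seq X I as = colon X I (\<Prod>a\<leftarrow>as. Var a)"

text \<open>With list positions starting at 0, the ideal seen by \<open>as ! i\<close> is the colon by the product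
  of the first \<open>i\<close> entries.\<close>

definition resolution :: "'a set \<Rightarrow> 'a int_mpoly set \<Rightarrow> 'a list \<Rightarrow> bool" where
  "resolution X I as \<longleftrightarrow> set as \<subseteq> X \<and>
     (\<forall>i < length as.
        Var (as ! i) \<notin> colon_seq X I (take i as) \<and>
        (is_cone X (colon_seq X I (take i as)) (as ! i) \<or>
         (\<exists>b \<in> X. dominates X (colon_seq X I (take i as)) (as ! i) b)))"

definition maximal_resolution :: "'a set \<Rightarrow> 'a int_mpoly set \<Rightarrow> 'a list \<Rightarrow> bool" where
  "maximal_resolution X I as \<longleftrightarrow> resolution X I as \<and> \<not> (\<exists>a. resolution X I (as @ [a]))"

text \<open>The core of a resolution \<open>as\<close> is \<open>colon_seq X I as\<close> and its depth is \<open>length as\<close>. The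
  entries of a resolution are distinct because \<open>I\<close> contains the squares of the variables, so
  for finite \<open>X\<close> maximal resolutions exist and the minimum below is attained.\<close>

definition resolution_depth :: "'a set \<Rightarrow> 'a int_mpoly set \<Rightarrow> nat" where
  "resolution_depth X I = (LEAST r. \<exists>as. maximal_resolution X I as \<and> length as = r)"

definition simple_ideal :: "'a set \<Rightarrow> 'a int_mpoly set \<Rightarrow> bool" where
  "simple_ideal X I \<longleftrightarrow>
     (\<exists>as. maximal_resolution X I as \<and> colon_seq X I as = Idl\<^bsub>int_poly_ring X\<^esub> (Var ` X))"


definition elementary_collapse :: "'a mon set \<Rightarrow> 'a mon set \<Rightarrow> bool" where
  "elementary_collapse \<Delta> \<Delta>' \<longleftrightarrow>
     (\<exists>\<sigma> \<in> \<Delta>. \<exists>\<tau> \<in> \<Delta>.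
        (\<forall>\<rho> \<in> \<Delta>. mon_dvd \<sigma> \<rho> \<longrightarrow> \<rho> = \<sigma>) \<and>
        mon_dvd \<tau> \<sigma> \<and> mon_degree \<sigma> = mon_degree \<tau> + 1 \<and>
        (\<forall>\<rho> \<in> \<Delta>. mon_dvd \<tau> \<rho> \<and> \<rho> \<noteq> \<tau> \<longrightarrow> \<rho> = \<sigma>) \<and>
        \<Delta>' = \<Delta> - {\<sigma>, \<tau>})"

definition collapses_onto :: "'a mon set \<Rightarrow> 'a mon set \<Rightarrow> bool" where
  "collapses_onto = elementary_collapse\<^sup>*\<^sup>*"

definition complex_vertices :: "'a mon set \<Rightarrow> 'a set" where
  "complex_vertices \<Delta> = {x. Poly_Mapping.single x 1 \<in> \<Delta>}"

definition rename_mon :: "('a \<Rightarrow> 'b) \<Rightarrow> 'a mon \<Rightarrow> 'b mon" where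
  "rename_mon f m = (\<Sum>x \<in> Poly_Mapping.keys m. Poly_Mapping.single (f x) (Poly_Mapping.lookup m x))"

definition complex_iso :: "'a mon set \<Rightarrow> 'b mon set \<Rightarrow> bool" where
  "complex_iso \<Delta> \<Gamma> \<longleftrightarrow>
     (\<exists>f. bij_betw f (complex_vertices \<Delta>) (complex_vertices \<Gamma>) \<and> rename_mon f ` \<Delta> = \<Gamma>)"

definition cross_polytope_boundary :: "nat \<Rightarrow> nat mon set" where
  "cross_polytope_boundary d = complex_of {1..2*d}
     (Idl\<^bsub>int_poly_ring {1..2*d}\<^esub> ((\<lambda>i. Var (2*i - 1) * Var (2*i)) ` {1..d} \<union> (\<lambda>j. (Var j)\<^sup>2) ` {1..2*d}))"


definition simple_graph :: "'a set \<Rightarrow> 'a set set \<Rightarrow> bool" where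
  "simple_graph V E \<longleftrightarrow> finite V \<and> (\<forall>e \<in> E. e \<subseteq> V \<and> card e = 2)"

definition graph_cycle :: "'a set set \<Rightarrow> 'a list \<Rightarrow> bool" where
  "graph_cycle E vs \<longleftrightarrow> length vs \<ge> 3 \<and> distinct vs \<and>
     (\<forall>i < length vs. {vs ! i, vs ! (Suc i mod length vs)} \<in> E)"

definition forest :: "'a set \<Rightarrow> 'a set set \<Rightarrow> bool" where
  "forest V E \<longleftrightarrow> simple_graph V E \<and> \<not> (\<exists>vs. graph_cycle E vs)"

definition closed_nbhd :: "'a set set \<Rightarrow> 'a \<Rightarrow> 'a set" where
  "closed_nbhd E v = insert v {u. {u, v} \<in> E}"

definition star_ideal :: "'a set \<Rightarrow> 'a set set \<Rightarrow> 'a int_mpoly set" where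
  "star_ideal V E = Idl\<^bsub>int_poly_ring V\<^esub>
     ((\<lambda>x. (Var x)\<^sup>2) ` V \<union> (\<lambda>x. \<Prod>y \<in> closed_nbhd E x. Var y) ` V)"

definition matching_number :: "'a set set \<Rightarrow> nat" where
  "matching_number E = Max (card ` {M. M \<subseteq> E \<and> disjoint M})"

definition vertex_cover_number :: "'a set \<Rightarrow> 'a set set \<Rightarrow> nat" where
  "vertex_cover_number V E = Min (card ` {C. C \<subseteq> V \<and> (\<forall>e \<in> E. e \<inter> C \<noteq> {})})"

end

theory Submission
  imports Defs
begin

text \<open>
  A monomial ideal containing the squares of the variables is determined by the supports of the
  monomials outside it, on which colon by a variable and adjunction of it act as link and deletion.
  If \<open>l\<close> is a leaf of a forest with neighbour \<open>p\<close>, then \<open>p\<close> dominates \<open>l\<close> and \<open>l p\<close> lies in the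
  star ideal, so up to collapses the dominance complex is the suspension, with poles \<open>p\<close> and \<open>l\<close>,
  of the link of \<open>p\<close>. This link is the dominance complex of the forest with the edges at \<open>p\<close>
  removed, whose matching and vertex covering numbers are one smaller. Iterating until no edge is
  left gives a resolution whose core is generated by the variables, a collapse onto a cross-polytope
  and the equality of the matching and covering numbers. A diamond argument shows that all maximal
  resolutions of an iterated suspension have the same depth.
\<close>

section \<open>Simplicial complexes and domination\<close>

definition simplicial_complex :: "'a set \<Rightarrow> 'a set set \<Rightarrow> bool" where
  "simplicial_complex X \<Delta> \<longleftrightarrow> \<Delta> \<subseteq> Fpow X \<and> (\<forall>\<sigma>\<in>\<Delta>. Pow \<sigma> \<subseteq> \<Delta>)"

definition link :: "'a set set \<Rightarrow> 'a \<Rightarrow> 'a set set" where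
  "link \<Delta> a = {\<sigma>. a \<notin> \<sigma> \<and> insert a \<sigma> \<in> \<Delta>}"

definition deletion :: "'a set set \<Rightarrow> 'a \<Rightarrow> 'a set set" where
  "deletion \<Delta> a = {\<sigma> \<in> \<Delta>. a \<notin> \<sigma>}"

definition cone_over :: "'a \<Rightarrow> 'a set set \<Rightarrow> 'a set set" where
  "cone_over a \<Delta> = \<Delta> \<union> insert a ` \<Delta>"

definition suspension :: "'a \<Rightarrow> 'a \<Rightarrow> 'a set set \<Rightarrow> 'a set set" where
  "suspension a b \<Delta> = cone_over a \<Delta> \<union> cone_over b \<Delta>"

definition cone_apex :: "'a set set \<Rightarrow> 'a \<Rightarrow> bool" where
  "cone_apex \<Delta> a \<longleftrightarrow> (\<forall>\<sigma>\<in>\<Delta>. insert a \<sigma> \<in> \<Delta>)"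

lemma simplicial_complex_face_subset:
  "simplicial_complex X \<Delta> \<Longrightarrow> \<sigma> \<in> \<Delta> \<Longrightarrow> \<tau> \<subseteq> \<sigma> \<Longrightarrow> \<tau> \<in> \<Delta>"
  by (auto simp: simplicial_complex_def)

lemma simplicial_complex_face_finite: "simplicial_complex X \<Delta> \<Longrightarrow> \<sigma> \<in> \<Delta> \<Longrightarrow> finite \<sigma>"
  by (auto simp: simplicial_complex_def Fpow_def)

lemma simplicial_complex_face_ground: "simplicial_complex X \<Delta> \<Longrightarrow> \<sigma> \<in> \<Delta> \<Longrightarrow> \<sigma> \<subseteq> X"
  by (auto simp: simplicial_complex_def Fpow_def)

lemma finite_simplicial_complex: "simplicial_complex X \<Delta> \<Longrightarrow> finite X \<Longrightarrow> finite \<Delta>"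
  unfolding simplicial_complex_def by (meson Fpow_subset_Pow finite_Pow_iff finite_subset)

lemma simplicial_complex_image:
  assumes "simplicial_complex X \<Delta>"
  shows "simplicial_complex (f ` X) ((`) f ` \<Delta>)"
  unfolding simplicial_complex_def
proof (intro conjI ballI subsetI)
  show "\<sigma> \<in> Fpow (f ` X)" if "\<sigma> \<in> (`) f ` \<Delta>" for \<sigma>
    using that assms by (auto simp: simplicial_complex_def Fpow_def)
  fix \<sigma> \<tau> assume "\<sigma> \<in> (`) f ` \<Delta>" "\<tau> \<in> Pow \<sigma>"
  then obtain \<sigma>' \<tau>' where "\<sigma>' \<in> \<Delta>" "\<tau>' \<subseteq> \<sigma>'" "\<tau> = f ` \<tau>'" by (auto simp: subset_image_iff)
  then show "\<tau> \<in> (`) f ` \<Delta>" using simplicial_complex_face_subset[OF assms] by blast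
qed

lemma simplicial_complex_link:
  assumes "simplicial_complex X \<Delta>"
  shows "simplicial_complex X (link \<Delta> a)"
proof -
  have "finite \<sigma> \<and> \<sigma> \<subseteq> X" if "\<sigma> \<in> link \<Delta> a" for \<sigma>
    using that assms by (auto simp: link_def simplicial_complex_def Fpow_def)
  moreover have "\<tau> \<in> link \<Delta> a" if "\<sigma> \<in> link \<Delta> a" "\<tau> \<subseteq> \<sigma>" for \<sigma> \<tau>
    using that simplicial_complex_face_subset[OF assms, of "insert a \<sigma>" "insert a \<tau>"]
    by (auto simp: link_def)
  ultimately show ?thesis by (auto simp: simplicial_complex_def Fpow_def)
qed

lemma simplicial_complex_deletion:
  assumes "simplicial_complex X \<Delta>"
  shows "simplicial_complex X (deletion \<Delta> a)"
  unfolding simplicial_complex_def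
proof (intro conjI ballI subsetI)
  show "\<sigma> \<in> Fpow X" if "\<sigma> \<in> deletion \<Delta> a" for \<sigma>
    using that assms by (auto simp: deletion_def simplicial_complex_def)
  show "\<tau> \<in> deletion \<Delta> a" if "\<sigma> \<in> deletion \<Delta> a" "\<tau> \<in> Pow \<sigma>" for \<sigma> \<tau>
    using that simplicial_complex_face_subset[OF assms, of \<sigma> \<tau>] by (auto simp: deletion_def)
qed

lemma simplicial_complex_cone_over:
  assumes "simplicial_complex X \<Delta>"
  shows "simplicial_complex (insert a X) (cone_over a \<Delta>)"
  unfolding simplicial_complex_def
proof (intro conjI ballI subsetI)
  show "\<sigma> \<in> Fpow (insert a X)" if "\<sigma> \<in> cone_over a \<Delta>" for \<sigma>
    using that assms by (auto simp: cone_over_def simplicial_complex_def Fpow_def)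
  fix \<sigma> \<tau> assume "\<sigma> \<in> cone_over a \<Delta>" "\<tau> \<in> Pow \<sigma>"
  then obtain \<rho> where \<rho>: "\<rho> \<in> \<Delta>" "\<tau> \<subseteq> insert a \<rho>" by (auto simp: cone_over_def)
  have "\<tau> - {a} \<in> \<Delta>" by (rule simplicial_complex_face_subset[OF assms \<rho>(1)]) (use \<rho>(2) in auto)
  moreover have "\<tau> = \<tau> - {a} \<or> \<tau> = insert a (\<tau> - {a})" by blast
  ultimately show "\<tau> \<in> cone_over a \<Delta>" unfolding cone_over_def by (metis UnI1 UnI2 imageI)
qed

lemma link_subset_deletion: "simplicial_complex X \<Delta> \<Longrightarrow> link \<Delta> a \<subseteq> deletion \<Delta> a"
  by (auto simp: link_def deletion_def intro: simplicial_complex_face_subset)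

lemma link_commute: "a \<noteq> b \<Longrightarrow> link (link \<Delta> a) b = link (link \<Delta> b) a"
  by (auto simp: link_def insert_commute)

lemma deletion_Un_link: "deletion \<Delta> a \<union> insert a ` link \<Delta> a = \<Delta>"
proof -
  have "\<sigma> \<in> insert a ` link \<Delta> a" if "\<sigma> \<in> \<Delta>" "a \<in> \<sigma>" for \<sigma>
    using that by (intro image_eqI[of _ _ "\<sigma> - {a}"]) (auto simp: link_def insert_absorb)
  then show ?thesis by (auto simp: deletion_def link_def)
qed

lemma cone_apex_iff_link_eq_deletion:
  assumes "simplicial_complex X \<Delta>"
  shows "cone_apex \<Delta> a \<longleftrightarrow> link \<Delta> a = deletion \<Delta> a"
proof
  assume "cone_apex \<Delta> a"
  then show "link \<Delta> a = deletion \<Delta> a"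
    using link_subset_deletion[OF assms] by (auto simp: cone_apex_def link_def deletion_def)
next
  assume "link \<Delta> a = deletion \<Delta> a"
  then have "insert a \<sigma> \<in> \<Delta>" if "\<sigma> \<in> \<Delta>" for \<sigma>
    using that by (cases "a \<in> \<sigma>") (auto simp: insert_absorb link_def deletion_def)
  then show "cone_apex \<Delta> a" by (simp add: cone_apex_def)
qed

lemma cone_apex_imp_cone_over:
  "simplicial_complex X \<Delta> \<Longrightarrow> cone_apex \<Delta> b \<Longrightarrow> \<Delta> = cone_over b (deletion \<Delta> b)"
  using deletion_Un_link[of \<Delta> b] by (simp add: cone_over_def cone_apex_iff_link_eq_deletion)

lemma cone_apex_link:
  "cone_apex \<Delta> c \<Longrightarrow> c \<noteq> a \<Longrightarrow> cone_apex (link \<Delta> a) c"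
  by (auto simp: cone_apex_def link_def insert_commute)

definition weakly_dominates :: "'a set set \<Rightarrow> 'a \<Rightarrow> 'a \<Rightarrow> bool" where
  "weakly_dominates \<Delta> a b \<longleftrightarrow> cone_apex (deletion \<Delta> a) b"

lemma weakly_dominatesI:
  "a \<noteq> b \<Longrightarrow> (\<And>\<sigma>. \<sigma> \<in> \<Delta> \<Longrightarrow> a \<notin> \<sigma> \<Longrightarrow> insert b \<sigma> \<in> \<Delta>) \<Longrightarrow> weakly_dominates \<Delta> a b"
  by (auto simp: weakly_dominates_def cone_apex_def deletion_def)

lemma weakly_dominatesD:
  assumes "weakly_dominates \<Delta> a b" "\<sigma> \<in> \<Delta>" "a \<notin> \<sigma>"
  shows "insert b \<sigma> \<in> \<Delta>" "a \<noteq> b"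
  using assms by (auto simp: weakly_dominates_def cone_apex_def deletion_def)

lemma weakly_dominates_trans:
  assumes "simplicial_complex X \<Delta>" "weakly_dominates \<Delta> a b" "weakly_dominates \<Delta> b c" "a \<noteq> c"
  shows "weakly_dominates \<Delta> a c"
proof (rule weakly_dominatesI[OF assms(4)])
  fix \<sigma> assume \<sigma>: "\<sigma> \<in> \<Delta>" "a \<notin> \<sigma>"
  have "\<sigma> - {b} \<in> \<Delta>" using simplicial_complex_face_subset[OF assms(1) \<sigma>(1)] by blast
  then have "insert c (\<sigma> - {b}) \<in> \<Delta>" using weakly_dominatesD(1)[OF assms(3)] by blast
  then have "insert b (insert c (\<sigma> - {b})) \<in> \<Delta>"
    using weakly_dominatesD(1)[OF assms(2)] \<sigma>(2) assms(4) by blast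
  then show "insert c \<sigma> \<in> \<Delta>" by (rule simplicial_complex_face_subset[OF assms(1)]) auto
qed

lemma weakly_dominates_link:
  assumes "weakly_dominates \<Delta> a b" "a \<noteq> c" "b \<noteq> c"
  shows "weakly_dominates (link \<Delta> c) a b"
  unfolding weakly_dominates_def cone_apex_def
proof
  fix \<sigma> assume "\<sigma> \<in> deletion (link \<Delta> c) a"
  then have \<sigma>: "insert c \<sigma> \<in> \<Delta>" "c \<notin> \<sigma>" "a \<notin> insert c \<sigma>"
    using assms(2) by (auto simp: link_def deletion_def)
  from weakly_dominatesD[OF assms(1) \<sigma>(1,3)]
  show "insert b \<sigma> \<in> deletion (link \<Delta> c) a"
    using \<sigma> assms(3) by (simp add: link_def deletion_def insert_commute)
qed

lemma adjacent_if_weakly_dominates_not_cone_link: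
  assumes "simplicial_complex X \<Delta>" "weakly_dominates \<Delta> c b" "a \<noteq> b" "a \<noteq> c"
    "\<not> cone_apex (link \<Delta> a) b"
  shows "{a, c} \<in> \<Delta>"
proof (rule ccontr)
  assume nonadjacent: "{a, c} \<notin> \<Delta>"
  have "insert b \<sigma> \<in> link \<Delta> a" if "\<sigma> \<in> link \<Delta> a" for \<sigma>
  proof -
    have \<sigma>: "a \<notin> \<sigma>" "insert a \<sigma> \<in> \<Delta>" using that by (auto simp: link_def)
    have "c \<notin> insert a \<sigma>"
      using simplicial_complex_face_subset[OF assms(1) \<sigma>(2), of "{a, c}"] nonadjacent assms(4)
      by auto
    from weakly_dominatesD(1)[OF assms(2) \<sigma>(2) this]
    show ?thesis using \<sigma>(1) assms(3) by (simp add: link_def insert_commute)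
  qed
  then show False using assms(5) by (simp add: cone_apex_def)
qed

lemma link_subset_link_nonadjacent:
  assumes "simplicial_complex X \<Delta>" "weakly_dominates \<Delta> a b" "{a, b} \<notin> \<Delta>"
  shows "link \<Delta> a \<subseteq> link \<Delta> b"
proof
  fix \<sigma> assume "\<sigma> \<in> link \<Delta> a"
  then have \<sigma>: "a \<notin> \<sigma>" "insert a \<sigma> \<in> \<Delta>" by (auto simp: link_def)
  then have "\<sigma> \<in> \<Delta>" using simplicial_complex_face_subset[OF assms(1)] by blast
  then have "insert b \<sigma> \<in> \<Delta>" using weakly_dominatesD(1)[OF assms(2)] \<sigma>(1) by blast
  moreover have "b \<notin> \<sigma>"
    using simplicial_complex_face_subset[OF assms(1) \<sigma>(2), of "{a, b}"] assms(3) by auto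
  ultimately show "\<sigma> \<in> link \<Delta> b" by (simp add: link_def)
qed

lemma link_eq_link_nonadjacent:
  assumes "simplicial_complex X \<Delta>" "weakly_dominates \<Delta> a b" "weakly_dominates \<Delta> b a" "{a, b} \<notin> \<Delta>"
  shows "link \<Delta> a = link \<Delta> b"
  using assms link_subset_link_nonadjacent[of X \<Delta>] by (simp add: insert_commute subset_antisym)

definition poles :: "'a set set \<Rightarrow> 'a \<Rightarrow> 'a \<Rightarrow> bool" where
  "poles \<Delta> a b \<longleftrightarrow> {a} \<in> \<Delta> \<and> {a, b} \<notin> \<Delta> \<and> weakly_dominates \<Delta> a b"

lemma poles_neq: "poles \<Delta> a b \<Longrightarrow> a \<noteq> b"
  by (auto simp: poles_def)

lemma poles_vertex:
  assumes "simplicial_complex X \<Delta>" "poles \<Delta> a b"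
  shows "{b} \<in> \<Delta>"
proof -
  have "{} \<in> \<Delta>"
    using assms simplicial_complex_face_subset[of X \<Delta> "{a}"] by (simp add: poles_def)
  then show ?thesis using assms(2) weakly_dominatesD(1)[of \<Delta> a b "{}"] by (simp add: poles_def)
qed

lemma poles_notin_link:
  assumes "simplicial_complex X \<Delta>" "poles \<Delta> a b"
  shows "b \<notin> \<Union>(link \<Delta> a)"
proof
  assume "b \<in> \<Union>(link \<Delta> a)"
  then obtain \<sigma> where "insert a \<sigma> \<in> \<Delta>" "{a, b} \<subseteq> insert a \<sigma>" by (auto simp: link_def)
  then have "{a, b} \<in> \<Delta>" by (rule simplicial_complex_face_subset[OF assms(1)])
  then show False using assms(2) by (simp add: poles_def)
qed

lemma poles_link:
  assumes "simplicial_complex X \<Delta>" "poles \<Delta> a b" "{a, c} \<in> \<Delta>" "a \<noteq> c"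
  shows "poles (link \<Delta> c) a b"
proof -
  have "b \<noteq> c" using assms(2,3) by (auto simp: poles_def)
  moreover have "insert c {a, b} \<notin> \<Delta>"
    using assms(2) simplicial_complex_face_subset[OF assms(1), of "insert c {a, b}" "{a, b}"]
    by (auto simp: poles_def)
  ultimately show ?thesis
    using assms weakly_dominates_link[of \<Delta> a b c]
    by (simp add: poles_def link_def insert_commute)
qed

text \<open>Up to a collapse of the cone with apex \<open>b\<close>, poles \<open>a\<close> and \<open>b\<close> make \<open>\<Delta>\<close> the suspension of the
  link of \<open>a\<close>.\<close>

inductive iterated_suspension :: "'a set set \<Rightarrow> nat \<Rightarrow> bool" where
  empty: "iterated_suspension {{}} 0"
| suspend: "poles \<Delta> a b \<Longrightarrow> iterated_suspension (link \<Delta> a) d \<Longrightarrow> iterated_suspension \<Delta> (Suc d)"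

lemma iterated_suspension_0_iff: "iterated_suspension \<Delta> 0 \<longleftrightarrow> \<Delta> = {{}}"
  by (auto elim: iterated_suspension.cases intro: iterated_suspension.empty)

lemma iterated_suspension_not_cone:
  "iterated_suspension \<Delta> d \<Longrightarrow> simplicial_complex X \<Delta> \<Longrightarrow> \<not> cone_apex \<Delta> c"
proof (induction rule: iterated_suspension.induct)
  case empty
  then show ?case by (auto simp: cone_apex_def)
next
  case (suspend \<Delta> a b d)
  show ?case
  proof (cases "c = a")
    case True
    have "{b} \<in> \<Delta>" "{a, b} \<notin> \<Delta>"
      using poles_vertex[OF suspend.prems] suspend.hyps(1) by (auto simp: poles_def)
    then show ?thesis using True by (auto simp: cone_apex_def)
  next
    case False
    then show ?thesis
      using suspend.IH[OF simplicial_complex_link[OF suspend.prems]] cone_apex_link by metis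
  qed
qed

lemma weakly_dominates_avoiding:
  assumes "simplicial_complex X \<Delta>" "weakly_dominates \<Delta> a b" "weakly_dominates \<Delta> c u" "a \<noteq> b"
    "u \<noteq> a \<or> b \<noteq> c"
  obtains w where "w \<noteq> a" "weakly_dominates \<Delta> c w"
proof (cases "u = a")
  case True
  then have "weakly_dominates \<Delta> c b"
    using weakly_dominates_trans[OF assms(1), of c a b] assms(2,3,5) by simp
  then show thesis by (rule that[OF assms(4)[symmetric]])
next
  case False
  then show thesis using assms(3) by (rule that)
qed

text \<open>A diamond argument: the step at \<open>c\<close> commutes with the first step at \<open>a\<close>, unless \<open>a\<close> and \<open>c\<close>
  are nonadjacent and weakly dominate each other; then their links agree.\<close>

lemma iterated_suspension_link:
  assumes "iterated_suspension \<Delta> e" "simplicial_complex X \<Delta>" "{c} \<in> \<Delta>" "weakly_dominates \<Delta> c u"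
  shows "\<exists>d. e = Suc d \<and> iterated_suspension (link \<Delta> c) d"
  using assms
proof (induction arbitrary: c u rule: iterated_suspension.induct)
  case empty
  then show ?case by auto
next
  case (suspend \<Delta> a b d)
  note complex = suspend.prems(1) and c_dom_u = suspend.prems(3)
  have a_dom_b: "weakly_dominates \<Delta> a b" and nonadjacent: "{a, b} \<notin> \<Delta>"
    using suspend.hyps(1) by (auto simp: poles_def)
  consider (same) "a = c" | (opposite) "u = a" "b = c" | (other) "a \<noteq> c" "u \<noteq> a \<or> b \<noteq> c"
    by blast
  then show ?case
  proof cases
    case same
    then show ?thesis using suspend.hyps(2) by blast
  next
    case opposite
    then have "link \<Delta> a = link \<Delta> c"
      using link_eq_link_nonadjacent[OF complex] a_dom_b c_dom_u nonadjacent by simp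
    then show ?thesis using suspend.hyps(2) by auto
  next
    case other
    note complex_a = simplicial_complex_link[OF complex, of a]
    obtain w where w: "w \<noteq> a" "weakly_dominates \<Delta> c w"
      using weakly_dominates_avoiding[OF complex a_dom_b c_dom_u]
        poles_neq[OF suspend.hyps(1)] other(2) by blast
    have "\<not> cone_apex (link \<Delta> a) w"
      by (rule iterated_suspension_not_cone[OF suspend.hyps(2) complex_a])
    then have adjacent: "{a, c} \<in> \<Delta>"
      using adjacent_if_weakly_dominates_not_cone_link[OF complex w(2)] w(1) other(1) by simp
    then have vertex: "{c} \<in> link \<Delta> a" using other(1) by (simp add: link_def)
    have "weakly_dominates (link \<Delta> a) c w"
      using weakly_dominates_link[OF w(2)] w(1) other(1) by simp
    from suspend.IH[OF complex_a vertex this]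
    obtain d' where "d = Suc d'" "iterated_suspension (link (link \<Delta> c) a) d'"
      by (auto simp: link_commute[OF other(1)])
    then show ?thesis
      using iterated_suspension.suspend[OF poles_link[OF complex suspend.hyps(1) adjacent other(1)]]
      by blast
  qed
qed

section \<open>Collapses\<close>

definition face_collapse :: "'a set set \<Rightarrow> 'a set set \<Rightarrow> bool" where
  "face_collapse \<Delta> \<Delta>' \<longleftrightarrow> (\<exists>\<tau> x. x \<notin> \<tau> \<and> \<tau> \<in> \<Delta> \<and> insert x \<tau> \<in> \<Delta> \<and>
    (\<forall>\<rho>\<in>\<Delta>. \<tau> \<subseteq> \<rho> \<longrightarrow> \<rho> = \<tau> \<or> \<rho> = insert x \<tau>) \<and> \<Delta>' = \<Delta> - {\<tau>, insert x \<tau>})"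

lemma face_collapses_subset: "face_collapse\<^sup>*\<^sup>* \<Delta> \<Delta>' \<Longrightarrow> \<Delta>' \<subseteq> \<Delta>"
  by (induction rule: rtranclp_induct) (auto simp: face_collapse_def)

lemma face_collapse_Un:
  assumes "face_collapse L L'" "simplicial_complex X A" "A \<inter> L \<subseteq> L'"
  shows "face_collapse (A \<union> L) (A \<union> L')"
proof -
  obtain \<tau> x where \<tau>: "x \<notin> \<tau>" "\<tau> \<in> L" "insert x \<tau> \<in> L"
    "\<And>\<rho>. \<rho> \<in> L \<Longrightarrow> \<tau> \<subseteq> \<rho> \<Longrightarrow> \<rho> = \<tau> \<or> \<rho> = insert x \<tau>" "L' = L - {\<tau>, insert x \<tau>}"
    using assms(1) unfolding face_collapse_def by blast
  then have notin: "\<tau> \<notin> A" "insert x \<tau> \<notin> A" using assms(3) by auto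
  then have "\<not> \<tau> \<subseteq> \<rho>" if "\<rho> \<in> A" for \<rho>
    using that simplicial_complex_face_subset[OF assms(2)] by blast
  moreover have "A \<union> L' = A \<union> L - {\<tau>, insert x \<tau>}" using \<tau>(5) notin by blast
  ultimately show ?thesis
    unfolding face_collapse_def using \<tau>(1-4) by (intro exI[of _ \<tau>] exI[of _ x]) auto
qed

lemma face_collapses_Un:
  assumes "face_collapse\<^sup>*\<^sup>* L L'" "simplicial_complex X A" "A \<inter> L \<subseteq> L'"
  shows "face_collapse\<^sup>*\<^sup>* (A \<union> L) (A \<union> L')"
  using assms(1,3)
proof (induction rule: rtranclp_induct)
  case (step M M')
  have "M \<subseteq> L" "M' \<subseteq> M"
    using face_collapses_subset step.hyps by (auto dest: r_into_rtranclp)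
  then have "face_collapse\<^sup>*\<^sup>* (A \<union> L) (A \<union> M)" "face_collapse (A \<union> M) (A \<union> M')"
    using step.IH step.prems face_collapse_Un[OF step.hyps(2) assms(2)] by blast+
  then show ?case by (rule rtranclp.rtrancl_into_rtrancl)
qed simp

lemma face_collapse_image_insert:
  assumes "face_collapse L L'" "a \<notin> \<Union>L"
  shows "face_collapse (insert a ` L) (insert a ` L')"
proof -
  obtain \<tau> x where \<tau>: "x \<notin> \<tau>" "\<tau> \<in> L" "insert x \<tau> \<in> L"
    "\<And>\<rho>. \<rho> \<in> L \<Longrightarrow> \<tau> \<subseteq> \<rho> \<Longrightarrow> \<rho> = \<tau> \<or> \<rho> = insert x \<tau>" "L' = L - {\<tau>, insert x \<tau>}"
    using assms(1) unfolding face_collapse_def by blast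
  have "inj_on (insert a) L" using assms(2) by (meson UnionI inj_onI insert_ident)
  from inj_on_image_set_diff[OF this, of L "{\<tau>, insert x \<tau>}"]
  have image: "insert a ` L' = insert a ` L - {insert a \<tau>, insert x (insert a \<tau>)}"
    using \<tau>(2,3,5) by (simp add: insert_commute)
  have "insert a \<rho> = insert a \<tau> \<or> insert a \<rho> = insert x (insert a \<tau>)"
    if "\<rho> \<in> L" "insert a \<tau> \<subseteq> insert a \<rho>" for \<rho>
  proof -
    have "\<tau> \<subseteq> \<rho>" using that(2) \<tau>(2) assms(2) by blast
    then show ?thesis using \<tau>(4)[OF that(1)] by (auto simp: insert_commute)
  qed
  moreover have "x \<notin> insert a \<tau>" using \<tau>(1,3) assms(2) by auto
  ultimately show ?thesis
    unfolding face_collapse_def image using \<tau>(2,3)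
    by (intro exI[of _ "insert a \<tau>"] exI[of _ x]) (auto simp: insert_commute[of x a])
qed

lemma face_collapses_image_insert:
  assumes "face_collapse\<^sup>*\<^sup>* L L'" "a \<notin> \<Union>L"
  shows "face_collapse\<^sup>*\<^sup>* (insert a ` L) (insert a ` L')"
  using assms(1)
proof (induction rule: rtranclp_induct)
  case (step M M')
  have "a \<notin> \<Union>M" using assms(2) face_collapses_subset[OF step.hyps(1)] by blast
  from step.IH face_collapse_image_insert[OF step.hyps(2) this] show ?case
    by (rule rtranclp.rtrancl_into_rtrancl)
qed simp

lemma face_collapse_cone_over_facet:
  assumes "b \<notin> \<Union>T" "\<tau> \<in> T" "\<And>\<sigma>. \<sigma> \<in> T \<Longrightarrow> \<tau> \<subseteq> \<sigma> \<Longrightarrow> \<sigma> = \<tau>"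
  shows "face_collapse (cone_over b T) (cone_over b (T - {\<tau>}))"
  unfolding face_collapse_def
proof (intro exI conjI ballI impI)
  have b: "b \<notin> \<sigma>" if "\<sigma> \<in> T" for \<sigma> using assms(1) that by blast
  show "b \<notin> \<tau>" by (rule b[OF assms(2)])
  show "\<tau> \<in> cone_over b T" "insert b \<tau> \<in> cone_over b T"
    using assms(2) by (auto simp: cone_over_def)
  show "\<rho> = \<tau> \<or> \<rho> = insert b \<tau>" if \<rho>: "\<rho> \<in> cone_over b T" "\<tau> \<subseteq> \<rho>" for \<rho>
  proof -
    obtain \<sigma> where "\<sigma> \<in> T" "\<rho> = \<sigma> \<or> \<rho> = insert b \<sigma>" using \<rho>(1) by (auto simp: cone_over_def)
    moreover from this have "\<tau> \<subseteq> \<sigma>" using \<rho>(2) b[OF assms(2)] by blast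
    ultimately show ?thesis using assms(3) by blast
  qed
  have "inj_on (insert b) T" using b by (meson inj_onI insert_ident)
  from inj_on_image_set_diff[OF this, of T "{\<tau>}"]
  have "insert b ` (T - {\<tau>}) = insert b ` T - {insert b \<tau>}" using assms(2) by simp
  moreover have "T - {\<tau>} = T - {\<tau>, insert b \<tau>}" using b by auto
  moreover have "insert b ` T - {insert b \<tau>} = insert b ` T - {\<tau>, insert b \<tau>}"
    using b[OF assms(2)] by auto
  ultimately show "cone_over b (T - {\<tau>}) = cone_over b T - {\<tau>, insert b \<tau>}"
    by (simp only: cone_over_def Un_Diff)
qed

lemma face_collapses_cone_over:
  assumes "finite T" "K \<subseteq> T" "simplicial_complex X K" "b \<notin> \<Union>T"
  shows "face_collapse\<^sup>*\<^sup>* (cone_over b T) (cone_over b K)"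
  using assms(1,2,4)
proof (induction T rule: finite_psubset_induct)
  case (psubset T)
  show ?case
  proof (cases "T = K")
    case False
    then have "finite (T - K)" "T - K \<noteq> {}" using psubset by auto
    then obtain \<tau> where \<tau>: "\<tau> \<in> T - K" "\<And>\<sigma>. \<sigma> \<in> T - K \<Longrightarrow> \<tau> \<subseteq> \<sigma> \<Longrightarrow> \<sigma> = \<tau>"
      by (metis finite_has_maximal)
    have "\<sigma> = \<tau>" if "\<sigma> \<in> T" "\<tau> \<subseteq> \<sigma>" for \<sigma>
      using that \<tau> simplicial_complex_face_subset[OF assms(3) _ that(2)] by blast
    then have "face_collapse (cone_over b T) (cone_over b (T - {\<tau>}))"
      using \<tau>(1) psubset.prems(2) by (intro face_collapse_cone_over_facet) auto
    moreover have "face_collapse\<^sup>*\<^sup>* (cone_over b (T - {\<tau>})) (cone_over b K)"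
      using \<tau>(1) psubset.prems by (intro psubset.IH) auto
    ultimately show ?thesis by (rule converse_rtranclp_into_rtranclp)
  qed simp
qed

lemma face_collapses_suspension:
  assumes complex: "simplicial_complex X \<Delta>" and "finite \<Delta>" and poles: "poles \<Delta> a b"
    and collapses: "face_collapse\<^sup>*\<^sup>* (link \<Delta> a) K" and K: "simplicial_complex Y K"
  shows "face_collapse\<^sup>*\<^sup>* \<Delta> (suspension a b K)"
proof -
  define D where "D = deletion \<Delta> a"
  define T where "T = deletion D b"
  have D: "simplicial_complex X D" unfolding D_def by (rule simplicial_complex_deletion[OF complex])
  have D_eq: "D = cone_over b T"
    unfolding T_def using poles
    by (intro cone_apex_imp_cone_over[OF D]) (simp add: poles_def weakly_dominates_def D_def)
  have K_sub: "K \<subseteq> link \<Delta> a" by (rule face_collapses_subset[OF collapses])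
  then have K_D: "K \<subseteq> D" unfolding D_def using link_subset_deletion[OF complex] by blast
  have "b \<notin> \<Union>K" using poles_notin_link[OF complex poles] K_sub by blast
  then have K_T: "K \<subseteq> T" using K_D by (auto simp: T_def deletion_def)
  have disjoint: "D \<inter> insert a ` L = {}" for L by (auto simp: D_def deletion_def)
  have "a \<notin> \<Union>(link \<Delta> a)" by (simp add: link_def)
  from face_collapses_Un[OF face_collapses_image_insert[OF collapses this] D]
  have "face_collapse\<^sup>*\<^sup>* (D \<union> insert a ` link \<Delta> a) (D \<union> insert a ` K)"
    by (simp add: disjoint)
  then have "face_collapse\<^sup>*\<^sup>* \<Delta> (D \<union> insert a ` K)" by (simp add: D_def deletion_Un_link)
  also have "D \<union> insert a ` K = (K \<union> D) \<union> insert a ` K" by (simp only: Un_absorb1[OF K_D])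
  also have "\<dots> = cone_over a K \<union> cone_over b T"
    by (simp only: cone_over_def[of a] D_eq[symmetric] Un_ac)
  also have "face_collapse\<^sup>*\<^sup>* (cone_over a K \<union> cone_over b T) (cone_over a K \<union> cone_over b K)"
  proof (rule face_collapses_Un[OF face_collapses_cone_over[OF _ K_T K]
        simplicial_complex_cone_over[OF K]])
    show "finite T" using \<open>finite \<Delta>\<close> by (simp add: T_def D_def deletion_def)
    show "b \<notin> \<Union>T" by (simp add: T_def deletion_def)
    have "cone_over a K \<inter> cone_over b T = D \<inter> K"
      by (simp add: cone_over_def[of a] Int_commute[of _ D] Int_Un_distrib disjoint flip: D_eq)
    then show "cone_over a K \<inter> cone_over b T \<subseteq> cone_over b K" by (auto simp: cone_over_def)
  qed
  finally show ?thesis by (simp add: suspension_def)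
qed

section \<open>Cross-polytopes\<close>

definition complex_avoiding :: "'a set \<Rightarrow> 'a set set \<Rightarrow> 'a set set" where
  "complex_avoiding X G = {\<sigma> \<in> Fpow X. \<forall>g\<in>G. \<not> g \<subseteq> \<sigma>}"

lemma simplicial_complex_avoiding: "simplicial_complex X (complex_avoiding X G)"
  unfolding simplicial_complex_def
proof (intro conjI ballI subsetI)
  fix \<sigma> \<tau> assume "\<sigma> \<in> complex_avoiding X G" "\<tau> \<in> Pow \<sigma>"
  then have \<sigma>: "\<tau> \<subseteq> \<sigma>" "\<sigma> \<subseteq> X" "finite \<sigma>" "\<And>g. g \<in> G \<Longrightarrow> \<not> g \<subseteq> \<sigma>"
    by (auto simp: complex_avoiding_def Fpow_def)
  then have "finite \<tau>" "\<And>g. g \<in> G \<Longrightarrow> \<not> g \<subseteq> \<tau>" using finite_subset by (blast, meson order_trans)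
  then show "\<tau> \<in> complex_avoiding X G" using \<sigma>(1,2) by (auto simp: complex_avoiding_def Fpow_def)
qed (simp add: complex_avoiding_def)

lemma complex_avoiding_suspension:
  assumes "a \<notin> X" "b \<notin> X" "a \<noteq> b" "G \<subseteq> Pow X"
  shows "complex_avoiding (insert a (insert b X)) (insert {a, b} G)
    = suspension a b (complex_avoiding X G)"
    (is "?\<Delta> = ?\<Sigma>")
proof (intro subset_antisym subsetI)
  fix \<sigma> assume \<sigma>: "\<sigma> \<in> ?\<Delta>"
  have "\<sigma> - {a, b} \<in> complex_avoiding X G"
    using \<sigma> by (auto simp: complex_avoiding_def Fpow_def)
  moreover have "\<sigma> = \<sigma> - {a, b} \<or> \<sigma> = insert a (\<sigma> - {a, b}) \<or> \<sigma> = insert b (\<sigma> - {a, b})"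
    using \<sigma> by (auto simp: complex_avoiding_def)
  ultimately show "\<sigma> \<in> ?\<Sigma>"
    unfolding suspension_def cone_over_def by (metis UnI1 UnI2 imageI)
next
  fix \<sigma> assume "\<sigma> \<in> ?\<Sigma>"
  then obtain \<tau> where \<tau>: "\<tau> \<in> complex_avoiding X G" "\<sigma> = \<tau> \<or> \<sigma> = insert a \<tau> \<or> \<sigma> = insert b \<tau>"
    unfolding suspension_def cone_over_def by blast
  have "\<not> g \<subseteq> \<sigma>" if "g \<in> G" for g
  proof -
    have "g \<subseteq> X" "\<not> g \<subseteq> \<tau>" using that assms(4) \<tau>(1) by (auto simp: complex_avoiding_def)
    then show ?thesis using \<tau>(2) assms(1,2) by blast
  qed
  moreover have "\<tau> \<subseteq> X" "finite \<tau>" using \<tau>(1) by (auto simp: complex_avoiding_def Fpow_def)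
  moreover have "\<not> {a, b} \<subseteq> \<sigma>" using \<tau>(2) \<open>\<tau> \<subseteq> X\<close> assms(1-3) by blast
  ultimately show "\<sigma> \<in> ?\<Delta>" using \<tau>(2) by (auto simp: complex_avoiding_def Fpow_def)
qed

lemma suspension_image: "(`) f ` suspension a b \<Delta> = suspension (f a) (f b) ((`) f ` \<Delta>)"
  by (simp add: suspension_def cone_over_def image_Un image_image)

definition cross_pairs :: "nat \<Rightarrow> nat set set" where
  "cross_pairs d = (\<lambda>i. {2*i - 1, 2*i}) ` {1..d}"

definition cross_faces :: "nat \<Rightarrow> nat set set" where
  "cross_faces d = complex_avoiding {1..2*d} (cross_pairs d)"

lemma cross_pairs_ground: "cross_pairs d \<subseteq> Pow {1..2*d}"
  by (auto simp: cross_pairs_def)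

lemma simplicial_complex_cross_faces: "simplicial_complex {1..2*d} (cross_faces d)"
  unfolding cross_faces_def by (rule simplicial_complex_avoiding)

lemma Union_cross_faces: "\<Union>(cross_faces d) = {1..2*d}"
proof
  show "\<Union>(cross_faces d) \<subseteq> {1..2*d}"
    using simplicial_complex_face_ground[OF simplicial_complex_cross_faces] by blast
  have "{j} \<in> cross_faces d" if "j \<in> {1..2*d}" for j
    using that by (auto simp: cross_faces_def complex_avoiding_def cross_pairs_def Fpow_def)
  then show "{1..2*d} \<subseteq> \<Union>(cross_faces d)" by blast
qed

lemma cross_faces_0: "cross_faces 0 = {{}}"
  by (auto simp: cross_faces_def complex_avoiding_def cross_pairs_def Fpow_def)

lemma cross_faces_Suc: "cross_faces (Suc d) = suspension (2*d + 1) (2*d + 2) (cross_faces d)"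
proof -
  have "{1..Suc d} = insert (Suc d) {1..d}" by auto
  then have pairs: "cross_pairs (Suc d) = insert {2*d + 1, 2*d + 2} (cross_pairs d)"
    by (simp add: cross_pairs_def)
  have "{1..2 * Suc d} = insert (2*d + 1) (insert (2*d + 2) {1..2*d})" by auto
  then show ?thesis
    unfolding cross_faces_def pairs
    using complex_avoiding_suspension[OF _ _ _ cross_pairs_ground, of "2*d + 1" d "2*d + 2"] by simp
qed

lemma suspension_cross_faces_image:
  assumes "inj_on g {1..2*d}" "a \<notin> g ` {1..2*d}" "b \<notin> g ` {1..2*d}" "a \<noteq> b"
  obtains h where "inj_on h {1..2 * Suc d}"
    "(`) h ` cross_faces (Suc d) = suspension a b ((`) g ` cross_faces d)"
proof
  let ?h = "g(2*d + 1 := a, 2*d + 2 := b)"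
  have h: "?h (2*d + 1) = a" "?h (2*d + 2) = b" by simp_all
  have h_g: "?h ` \<sigma> = g ` \<sigma>" if "\<sigma> \<subseteq> {1..2*d}" for \<sigma>
    using that by (intro image_cong) auto
  then have "(`) ?h ` cross_faces d = (`) g ` cross_faces d"
    using simplicial_complex_face_ground[OF simplicial_complex_cross_faces] by (metis image_cong)
  then show "(`) ?h ` cross_faces (Suc d) = suspension a b ((`) g ` cross_faces d)"
    by (simp only: cross_faces_Suc suspension_image h)
  have "inj_on ?h {1..2*d}" using assms(1) by (subst inj_on_cong[of _ _ g]) auto
  then have "inj_on ?h (insert (2*d + 2) {1..2*d})"
    unfolding inj_on_insert h using h_g[of "{1..2*d}"] assms(3) by simp
  moreover have "a \<notin> ?h ` insert (2*d + 2) {1..2*d}"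
    unfolding image_insert h using h_g[of "{1..2*d}"] assms(2,4) by simp
  moreover have "{1..2 * Suc d} = insert (2*d + 1) (insert (2*d + 2) {1..2*d})" by auto
  ultimately show "inj_on ?h {1..2 * Suc d}" by (simp add: inj_on_insert)
qed

lemma iterated_suspension_collapses:
  assumes "iterated_suspension \<Delta> d" "simplicial_complex X \<Delta>" "finite \<Delta>"
  shows "\<exists>g. inj_on g {1..2*d} \<and> face_collapse\<^sup>*\<^sup>* \<Delta> ((`) g ` cross_faces d)"
  using assms
proof (induction rule: iterated_suspension.induct)
  case empty
  then show ?case by (auto simp: cross_faces_0)
next
  case (suspend \<Delta> a b d)
  note complex = suspend.prems(1) and poles = suspend.hyps(1)
  have "finite (link \<Delta> a)"
    using finite_subset[OF link_subset_deletion[OF complex]] suspend.prems(2)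
    by (simp add: deletion_def)
  from suspend.IH[OF simplicial_complex_link[OF complex] this]
  obtain g where g: "inj_on g {1..2*d}" "face_collapse\<^sup>*\<^sup>* (link \<Delta> a) ((`) g ` cross_faces d)"
    by blast
  have "g ` {1..2*d} = \<Union>((`) g ` cross_faces d)"
    by (simp only: Union_cross_faces flip: image_Union)
  also have "\<dots> \<subseteq> \<Union>(link \<Delta> a)" by (rule Union_mono[OF face_collapses_subset[OF g(2)]])
  finally have "g ` {1..2*d} \<subseteq> \<Union>(link \<Delta> a)" .
  moreover have "a \<notin> \<Union>(link \<Delta> a)" by (simp add: link_def)
  moreover have "b \<notin> \<Union>(link \<Delta> a)" by (rule poles_notin_link[OF complex poles])
  ultimately have "a \<notin> g ` {1..2*d}" "b \<notin> g ` {1..2*d}" by blast+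
  then obtain h where h: "inj_on h {1..2 * Suc d}"
    "(`) h ` cross_faces (Suc d) = suspension a b ((`) g ` cross_faces d)"
    by (rule suspension_cross_faces_image[OF g(1) _ _ poles_neq[OF poles]])
  have "face_collapse\<^sup>*\<^sup>* \<Delta> (suspension a b ((`) g ` cross_faces d))"
    by (rule face_collapses_suspension[OF complex suspend.prems(2) poles g(2)
        simplicial_complex_image[OF simplicial_complex_cross_faces]])
  then show ?case using h by metis
qed

section \<open>Monomial ideals\<close>

lemma mon_poly_add: "mon_poly (m + n) = mon_poly m * mon_poly n"
  by (simp add: mon_poly_def mult_single)

lemma keys_mon_poly [simp]: "Poly_Mapping.keys (mon_poly m) = {m}"
  by (simp add: mon_poly_def)

lemma lookup_mon_poly_mult:
  "Poly_Mapping.lookup (mon_poly k * q) (k + m) = Poly_Mapping.lookup q m"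
  using subset_UNIV
proof (induction q rule: frag_induction)
  case (one n)
  then show ?case by (simp add: mon_poly_def mult_single lookup_single)
qed (simp_all add: right_diff_distrib lookup_minus)

lemma keys_mon_poly_mult: "Poly_Mapping.keys (mon_poly k * q) = (+) k ` Poly_Mapping.keys q"
proof
  show "Poly_Mapping.keys (mon_poly k * q) \<subseteq> (+) k ` Poly_Mapping.keys q"
    using keys_mult[of "mon_poly k" q] by auto
  show "(+) k ` Poly_Mapping.keys q \<subseteq> Poly_Mapping.keys (mon_poly k * q)"
    by (auto simp: in_keys_iff lookup_mon_poly_mult)
qed

lemma mon_dvd_iff: "mon_dvd m n \<longleftrightarrow> (\<forall>x. Poly_Mapping.lookup m x \<le> Poly_Mapping.lookup n x)"
proof
  assume "\<forall>x. Poly_Mapping.lookup m x \<le> Poly_Mapping.lookup n x"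
  then have "n = m + (n - m)" by (intro poly_mapping_eqI) (simp add: lookup_add lookup_minus)
  then show "mon_dvd m n" unfolding mon_dvd_def by blast
qed (auto simp: mon_dvd_def lookup_add)

lemma mon_dvd_single_iff:
  "mon_dvd (Poly_Mapping.single x e) m \<longleftrightarrow> e \<le> Poly_Mapping.lookup m x"
  by (auto simp: mon_dvd_iff lookup_single when_def)

lemma ring_int_poly_ring: "ring (int_poly_ring X)"
  using cring_int_poly_ring by (rule cring.axioms(1))

lemma carrier_int_poly_ring_iff:
  "p \<in> carrier (int_poly_ring X) \<longleftrightarrow> (\<forall>m\<in>Poly_Mapping.keys p. Poly_Mapping.keys m \<subseteq> X)"
  by (simp add: int_poly_ring_def)

lemma mult_int_poly_ring [simp]: "p \<otimes>\<^bsub>int_poly_ring X\<^esub> q = p * q"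
  by (simp add: int_poly_ring_def)

lemma add_int_poly_ring [simp]: "p \<oplus>\<^bsub>int_poly_ring X\<^esub> q = p + q"
  by (simp add: int_poly_ring_def)

lemma zero_int_poly_ring [simp]: "\<zero>\<^bsub>int_poly_ring X\<^esub> = 0"
  by (simp add: int_poly_ring_def)

lemma uminus_int_poly_ring [simp]:
  assumes "p \<in> carrier (int_poly_ring X)"
  shows "\<ominus>\<^bsub>int_poly_ring X\<^esub> p = - p"
proof -
  interpret ring "int_poly_ring X" by (rule ring_int_poly_ring)
  show ?thesis using assms by (intro minus_equality) (simp_all add: carrier_int_poly_ring_iff)
qed

lemma mon_poly_carrier [simp]:
  "mon_poly m \<in> carrier (int_poly_ring X) \<longleftrightarrow> Poly_Mapping.keys m \<subseteq> X"
  by (simp add: carrier_int_poly_ring_iff)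

lemma Var_carrier [simp]: "Var x \<in> carrier (int_poly_ring X) \<longleftrightarrow> x \<in> X"
  by (simp add: Var_def)

definition monomial_ideal :: "'a set \<Rightarrow> 'a mon set \<Rightarrow> 'a int_mpoly set" where
  "monomial_ideal X N = {p \<in> carrier (int_poly_ring X). Poly_Mapping.keys p \<subseteq> N}"

definition mon_up_closed :: "'a mon set \<Rightarrow> bool" where
  "mon_up_closed N \<longleftrightarrow> (\<forall>m\<in>N. \<forall>n. mon_dvd m n \<longrightarrow> n \<in> N)"

lemma mon_poly_in_monomial_ideal [simp]:
  "mon_poly m \<in> monomial_ideal X N \<longleftrightarrow> Poly_Mapping.keys m \<subseteq> X \<and> m \<in> N"
  by (simp add: monomial_ideal_def)

lemma complex_of_monomial_ideal:
  "complex_of X (monomial_ideal X N) = {m. Poly_Mapping.keys m \<subseteq> X \<and> m \<notin> N}"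
  by (auto simp: complex_of_def)

lemma monomial_ideal_closed_mult:
  assumes "mon_up_closed N" "p \<in> monomial_ideal X N" "q \<in> carrier (int_poly_ring X)"
  shows "p * q \<in> monomial_ideal X N"
proof -
  have "m \<in> N" if m: "m \<in> Poly_Mapping.keys (p * q)" for m
  proof -
    obtain k l where "m = k + l" "k \<in> Poly_Mapping.keys p" using subsetD[OF keys_mult m] by auto
    then show ?thesis
      using assms(1,2) by (auto simp: mon_up_closed_def mon_dvd_def monomial_ideal_def)
  qed
  moreover have "p * q \<in> carrier (int_poly_ring X)"
    using int_poly_ring_mult_closed assms(2,3) by (auto simp: monomial_ideal_def)
  ultimately show ?thesis by (auto simp: monomial_ideal_def)
qed

lemma ideal_monomial_ideal:
  assumes "mon_up_closed N"
  shows "ideal (monomial_ideal X N) (int_poly_ring X)"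
proof (rule idealI[OF ring_int_poly_ring])
  interpret R: ring "int_poly_ring X" by (rule ring_int_poly_ring)
  show "subgroup (monomial_ideal X N) (add_monoid (int_poly_ring X))"
  proof (rule R.add.subgroupI)
    show "monomial_ideal X N \<subseteq> carrier (int_poly_ring X)" by (auto simp: monomial_ideal_def)
    have "0 \<in> monomial_ideal X N" by (simp add: monomial_ideal_def carrier_int_poly_ring_iff)
    then show "monomial_ideal X N \<noteq> {}" by blast
    show "\<ominus>\<^bsub>int_poly_ring X\<^esub> p \<in> monomial_ideal X N" if "p \<in> monomial_ideal X N" for p
      using that by (simp add: monomial_ideal_def carrier_int_poly_ring_iff)
    show "p \<oplus>\<^bsub>int_poly_ring X\<^esub> q \<in> monomial_ideal X N"
      if "p \<in> monomial_ideal X N" "q \<in> monomial_ideal X N" for p q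
      using that keys_add[of p q] by (auto simp: monomial_ideal_def int_poly_ring_add_closed)
  qed
next
  fix p q assume "p \<in> monomial_ideal X N" "q \<in> carrier (int_poly_ring X)"
  from monomial_ideal_closed_mult[OF assms this]
  show "q \<otimes>\<^bsub>int_poly_ring X\<^esub> p \<in> monomial_ideal X N" "p \<otimes>\<^bsub>int_poly_ring X\<^esub> q \<in> monomial_ideal X N"
    by (simp_all add: mult.commute)
qed

lemma monomial_ideal_subset_ideal:
  assumes "ideal I (int_poly_ring X)"
    "\<And>m. Poly_Mapping.keys m \<subseteq> X \<Longrightarrow> m \<in> N \<Longrightarrow> mon_poly m \<in> I"
  shows "monomial_ideal X N \<subseteq> I"
proof
  interpret I: additive_subgroup I "int_poly_ring X" by (rule ideal.axioms(1)[OF assms(1)])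
  fix p assume "p \<in> monomial_ideal X N"
  then have "Poly_Mapping.keys p \<subseteq> {m \<in> N. Poly_Mapping.keys m \<subseteq> X}"
    by (auto simp: monomial_ideal_def carrier_int_poly_ring_iff)
  then show "p \<in> I"
  proof (induction p rule: frag_induction)
    case zero
    then show ?case using I.zero_closed by simp
  next
    case (one m)
    then show ?case using assms(2) by (simp flip: mon_poly_def)
  next
    case (diff p q)
    then have "- q \<in> I" using I.a_inv_closed[of q] by simp
    then show ?case using diff I.a_closed[of p "- q"] by simp
  qed
qed

lemma genideal_eq_monomial_ideal:
  assumes "mon_up_closed N" "S \<subseteq> monomial_ideal X N"
    and generators: "\<And>m. Poly_Mapping.keys m \<subseteq> X \<Longrightarrow> m \<in> N \<Longrightarrow> \<exists>n. mon_dvd n m \<and> mon_poly n \<in> S"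
  shows "Idl\<^bsub>int_poly_ring X\<^esub> S = monomial_ideal X N"
proof
  interpret R: ring "int_poly_ring X" by (rule ring_int_poly_ring)
  show "Idl\<^bsub>int_poly_ring X\<^esub> S \<subseteq> monomial_ideal X N"
    by (rule R.genideal_minimal[OF ideal_monomial_ideal[OF assms(1)] assms(2)])
  have S: "S \<subseteq> carrier (int_poly_ring X)" using assms(2) by (auto simp: monomial_ideal_def)
  interpret I: ideal "Idl\<^bsub>int_poly_ring X\<^esub> S" "int_poly_ring X" by (rule R.genideal_ideal[OF S])
  show "monomial_ideal X N \<subseteq> Idl\<^bsub>int_poly_ring X\<^esub> S"
  proof (rule monomial_ideal_subset_ideal[OF I.ideal_axioms])
    fix m assume m: "Poly_Mapping.keys m \<subseteq> X" "m \<in> N"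
    obtain n k where n: "m = n + k" "mon_poly n \<in> S"
      using generators[OF m] by (auto simp: mon_dvd_def)
    then have "Poly_Mapping.keys k \<subseteq> X" using m(1) by (auto simp: in_keys_iff lookup_add)
    then show "mon_poly m \<in> Idl\<^bsub>int_poly_ring X\<^esub> S"
      using I.I_r_closed[of "mon_poly n" "mon_poly k"] subsetD[OF R.genideal_self[OF S] n(2)]
      by (simp add: n(1) mon_poly_add)
  qed
qed

lemma colon_monomial_ideal:
  assumes "Poly_Mapping.keys k \<subseteq> X"
  shows "colon X (monomial_ideal X N) (mon_poly k) = monomial_ideal X {m. k + m \<in> N}"
proof -
  have "mon_poly k * q \<in> carrier (int_poly_ring X)" if "q \<in> carrier (int_poly_ring X)" for q
    using that assms by (simp add: int_poly_ring_mult_closed)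
  then show ?thesis by (auto simp: colon_def monomial_ideal_def keys_mon_poly_mult)
qed

lemma adjoin_monomial_ideal:
  assumes "mon_up_closed N" "Poly_Mapping.keys k \<subseteq> X"
  shows "adjoin X (monomial_ideal X N) (mon_poly k) = monomial_ideal X (N \<union> {m. mon_dvd k m})"
  unfolding adjoin_def
proof (rule genideal_eq_monomial_ideal)
  show "mon_up_closed (N \<union> {m. mon_dvd k m})"
    using assms(1) by (auto simp: mon_up_closed_def mon_dvd_iff intro: order_trans)
  show "insert (mon_poly k) (monomial_ideal X N) \<subseteq> monomial_ideal X (N \<union> {m. mon_dvd k m})"
    using assms(2) by (auto simp: monomial_ideal_def mon_dvd_iff)
  fix m assume m: "Poly_Mapping.keys m \<subseteq> X" "m \<in> N \<union> {m. mon_dvd k m}"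
  have "mon_dvd m m" by (simp add: mon_dvd_iff)
  then show "\<exists>n. mon_dvd n m \<and> mon_poly n \<in> insert (mon_poly k) (monomial_ideal X N)"
    using m by auto
qed

section \<open>Ideals of nonfaces\<close>

definition mon_of :: "'a set \<Rightarrow> 'a mon" where
  "mon_of \<sigma> = (\<Sum>x\<in>\<sigma>. Poly_Mapping.single x 1)"

lemma lookup_mon_of: "finite \<sigma> \<Longrightarrow> Poly_Mapping.lookup (mon_of \<sigma>) x = (if x \<in> \<sigma> then 1 else 0)"
  by (simp add: mon_of_def lookup_sum lookup_single when_def)

lemma keys_mon_of [simp]: "finite \<sigma> \<Longrightarrow> Poly_Mapping.keys (mon_of \<sigma>) = \<sigma>"
  by (auto simp: in_keys_iff lookup_mon_of split: if_splits)

lemma mon_of_empty [simp]: "mon_of {} = 0"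
  by (simp add: mon_of_def)

lemma mon_of_singleton [simp]: "mon_of {x} = Poly_Mapping.single x 1"
  by (simp add: mon_of_def)

lemma mon_of_insert:
  "finite \<sigma> \<Longrightarrow> a \<notin> \<sigma> \<Longrightarrow> mon_of (insert a \<sigma>) = Poly_Mapping.single a 1 + mon_of \<sigma>"
  by (simp add: mon_of_def)

lemma mon_of_inject: "finite \<sigma> \<Longrightarrow> finite \<tau> \<Longrightarrow> mon_of \<sigma> = mon_of \<tau> \<longleftrightarrow> \<sigma> = \<tau>"
  by (metis keys_mon_of)

lemma mon_of_image_iff:
  "simplicial_complex X \<Delta> \<Longrightarrow> finite \<sigma> \<Longrightarrow> mon_of \<sigma> \<in> mon_of ` \<Delta> \<longleftrightarrow> \<sigma> \<in> \<Delta>"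
  using simplicial_complex_face_finite mon_of_inject by (metis (no_types, lifting) image_iff)

lemma mon_dvd_mon_of_iff:
  "finite \<sigma> \<Longrightarrow> finite \<tau> \<Longrightarrow> mon_dvd (mon_of \<tau>) (mon_of \<sigma>) \<longleftrightarrow> \<tau> \<subseteq> \<sigma>"
  by (auto simp: mon_dvd_iff lookup_mon_of)

lemma mon_degree_mon_of: "finite \<sigma> \<Longrightarrow> mon_degree (mon_of \<sigma>) = card \<sigma>"
  by (simp add: mon_degree_def lookup_mon_of)

lemma prod_Var: "finite \<sigma> \<Longrightarrow> (\<Prod>x\<in>\<sigma>. Var x) = mon_poly (mon_of \<sigma>)"
  by (induction \<sigma> rule: finite_induct)
    (simp_all add: mon_of_insert mon_poly_add Var_def, simp add: mon_poly_def)

lemma mon_of_keys_or_square_dvd: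
  "mon_of (Poly_Mapping.keys m) = m \<or> (\<exists>x. mon_dvd (Poly_Mapping.single x 2) m)"
proof (cases "\<exists>x. 2 \<le> Poly_Mapping.lookup m x")
  case True
  then show ?thesis by (auto simp: mon_dvd_single_iff)
next
  case False
  have "Poly_Mapping.lookup (mon_of (Poly_Mapping.keys m)) x = Poly_Mapping.lookup m x" for x
  proof -
    have "\<not> 2 \<le> Poly_Mapping.lookup m x" using False by blast
    then have "Poly_Mapping.lookup m x = 0 \<or> Poly_Mapping.lookup m x = 1" by linarith
    then show ?thesis by (auto simp: lookup_mon_of in_keys_iff)
  qed
  then show ?thesis by (blast intro: poly_mapping_eqI)
qed

lemma mon_dvd_mon_ofE:
  assumes "mon_dvd m (mon_of \<sigma>)" "finite \<sigma>"
  obtains \<tau> where "\<tau> \<subseteq> \<sigma>" "m = mon_of \<tau>"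
proof
  have le: "Poly_Mapping.lookup m x \<le> (if x \<in> \<sigma> then 1 else 0)" for x
    using assms(1) lookup_mon_of[OF assms(2), of x] by (metis mon_dvd_iff)
  then show "Poly_Mapping.keys m \<subseteq> \<sigma>" by (metis in_keys_iff le_zero_eq subsetI)
  have "\<not> mon_dvd (Poly_Mapping.single x 2) m" for x
    using le[of x] by (auto simp: mon_dvd_single_iff split: if_splits)
  then show "m = mon_of (Poly_Mapping.keys m)" using mon_of_keys_or_square_dvd[of m] by metis
qed

lemma mon_up_closed_nonfaces:
  assumes "simplicial_complex X \<Delta>"
  shows "mon_up_closed (- mon_of ` \<Delta>)"
proof -
  have "m \<in> mon_of ` \<Delta>" if "\<sigma> \<in> \<Delta>" "mon_dvd m (mon_of \<sigma>)" for m \<sigma>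
    using mon_dvd_mon_ofE[OF that(2) simplicial_complex_face_finite[OF assms that(1)]]
      simplicial_complex_face_subset[OF assms that(1)] by (metis imageI)
  then show ?thesis by (auto simp: mon_up_closed_def)
qed

lemma single_add_mon_of_image_iff:
  assumes "simplicial_complex X \<Delta>"
  shows "Poly_Mapping.single a 1 + m \<in> mon_of ` \<Delta> \<longleftrightarrow> m \<in> mon_of ` link \<Delta> a"
proof
  assume "Poly_Mapping.single a 1 + m \<in> mon_of ` \<Delta>"
  then obtain \<sigma> where \<sigma>: "Poly_Mapping.single a 1 + m = mon_of \<sigma>" "\<sigma> \<in> \<Delta>" by auto
  have fin: "finite \<sigma>" using simplicial_complex_face_finite[OF assms \<sigma>(2)] .
  have "mon_dvd m (mon_of \<sigma>)" by (simp flip: \<sigma>(1) add: mon_dvd_iff lookup_add)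
  then obtain \<tau> where \<tau>: "\<tau> \<subseteq> \<sigma>" "m = mon_of \<tau>" using fin by (rule mon_dvd_mon_ofE)
  have fin_\<tau>: "finite \<tau>" using \<tau>(1) fin by (rule finite_subset)
  have "1 + Poly_Mapping.lookup m a = Poly_Mapping.lookup (mon_of \<sigma>) a"
    by (simp flip: \<sigma>(1) add: lookup_add)
  then have a: "a \<notin> \<tau>" by (auto simp: \<tau>(2) lookup_mon_of fin fin_\<tau> split: if_splits)
  then have "mon_of (insert a \<tau>) = mon_of \<sigma>" using \<sigma>(1) \<tau>(2) mon_of_insert[OF fin_\<tau>] by simp
  then have "insert a \<tau> = \<sigma>" using fin fin_\<tau> by (simp add: mon_of_inject)
  then show "m \<in> mon_of ` link \<Delta> a" using \<tau>(2) a \<sigma>(2) by (simp add: link_def)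
next
  assume "m \<in> mon_of ` link \<Delta> a"
  then obtain \<sigma> where \<sigma>: "a \<notin> \<sigma>" "insert a \<sigma> \<in> \<Delta>" "m = mon_of \<sigma>" by (auto simp: link_def)
  then have "finite \<sigma>" using simplicial_complex_face_finite[OF assms] by (metis finite_insert)
  then show "Poly_Mapping.single a 1 + m \<in> mon_of ` \<Delta>" using \<sigma> mon_of_insert by (metis imageI)
qed

definition nonface_ideal :: "'a set \<Rightarrow> 'a set set \<Rightarrow> 'a int_mpoly set" where
  "nonface_ideal X \<Delta> = monomial_ideal X (- mon_of ` \<Delta>)"

lemma nonface_ideal_carrier: "nonface_ideal X \<Delta> \<subseteq> carrier (int_poly_ring X)"
  by (auto simp: nonface_ideal_def monomial_ideal_def)

lemma mon_poly_mon_of_in_nonface_ideal: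
  "simplicial_complex X \<Delta> \<Longrightarrow> \<sigma> \<subseteq> X \<Longrightarrow> finite \<sigma> \<Longrightarrow>
    mon_poly (mon_of \<sigma>) \<in> nonface_ideal X \<Delta> \<longleftrightarrow> \<sigma> \<notin> \<Delta>"
  by (simp add: nonface_ideal_def mon_of_image_iff)

lemma Var_in_nonface_ideal:
  "simplicial_complex X \<Delta> \<Longrightarrow> x \<in> X \<Longrightarrow> Var x \<in> nonface_ideal X \<Delta> \<longleftrightarrow> {x} \<notin> \<Delta>"
  using mon_poly_mon_of_in_nonface_ideal[of X \<Delta> "{x}"] by (simp add: Var_def)

lemma complex_of_nonface_ideal:
  assumes "simplicial_complex X \<Delta>"
  shows "complex_of X (nonface_ideal X \<Delta>) = mon_of ` \<Delta>"
proof -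
  have "Poly_Mapping.keys (mon_of \<sigma>) \<subseteq> X" if "\<sigma> \<in> \<Delta>" for \<sigma>
    using that simplicial_complex_face_finite[OF assms] simplicial_complex_face_ground[OF assms]
    by simp
  then show ?thesis by (auto simp: nonface_ideal_def complex_of_monomial_ideal)
qed

lemma nonface_ideal_inject:
  assumes "simplicial_complex X \<Delta>" "simplicial_complex X \<Gamma>"
  shows "nonface_ideal X \<Delta> = nonface_ideal X \<Gamma> \<longleftrightarrow> \<Delta> = \<Gamma>"
proof
  have inverse: "Poly_Mapping.keys ` mon_of ` \<Delta> = \<Delta>" if "simplicial_complex X \<Delta>" for \<Delta>
    using simplicial_complex_face_finite[OF that] by (simp add: image_image)
  assume "nonface_ideal X \<Delta> = nonface_ideal X \<Gamma>"
  then have "mon_of ` \<Delta> = mon_of ` \<Gamma>" using complex_of_nonface_ideal assms by metis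
  then show "\<Delta> = \<Gamma>" using inverse assms by metis
qed simp

lemma colon_nonface_ideal:
  assumes "simplicial_complex X \<Delta>" "a \<in> X"
  shows "colon X (nonface_ideal X \<Delta>) (Var a) = nonface_ideal X (link \<Delta> a)"
proof -
  have "{m. Poly_Mapping.single a 1 + m \<in> - mon_of ` \<Delta>} = - mon_of ` link \<Delta> a"
    using single_add_mon_of_image_iff[OF assms(1), of a] by auto
  then show ?thesis
    unfolding nonface_ideal_def Var_def using assms(2) by (subst colon_monomial_ideal) auto
qed

lemma adjoin_nonface_ideal:
  assumes "simplicial_complex X \<Delta>" "a \<in> X"
  shows "adjoin X (nonface_ideal X \<Delta>) (Var a) = nonface_ideal X (deletion \<Delta> a)"
proof -
  have "mon_dvd (Poly_Mapping.single a 1) (mon_of \<sigma>) \<longleftrightarrow> a \<in> \<sigma>" if "\<sigma> \<in> \<Delta>" for \<sigma>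
    using simplicial_complex_face_finite[OF assms(1) that]
    by (simp add: mon_dvd_single_iff lookup_mon_of)
  then have "- mon_of ` \<Delta> \<union> {m. mon_dvd (Poly_Mapping.single a 1) m} = - mon_of ` deletion \<Delta> a"
    by (auto simp: deletion_def)
  then show ?thesis
    unfolding nonface_ideal_def Var_def using assms(2) mon_up_closed_nonfaces[OF assms(1)]
    by (subst adjoin_monomial_ideal) auto
qed

lemma is_cone_nonface_ideal:
  assumes "simplicial_complex X \<Delta>" "a \<in> X"
  shows "is_cone X (nonface_ideal X \<Delta>) a \<longleftrightarrow> cone_apex \<Delta> a"
  using assms
  by (simp add: is_cone_def colon_nonface_ideal adjoin_nonface_ideal nonface_ideal_inject
      simplicial_complex_link simplicial_complex_deletion cone_apex_iff_link_eq_deletion)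

lemma dominates_nonface_ideal:
  assumes "simplicial_complex X \<Delta>" "a \<in> X" "b \<in> X"
  shows "dominates X (nonface_ideal X \<Delta>) a b \<longleftrightarrow> \<not> cone_apex \<Delta> b \<and> weakly_dominates \<Delta> a b"
  using assms
  by (simp add: dominates_def is_cone_nonface_ideal adjoin_nonface_ideal
      simplicial_complex_deletion weakly_dominates_def)

lemma genideal_Var: "Idl\<^bsub>int_poly_ring X\<^esub> (Var ` X) = nonface_ideal X {{}}"
  unfolding nonface_ideal_def
proof (rule genideal_eq_monomial_ideal)
  have complex: "simplicial_complex X {{}}" by (simp add: simplicial_complex_def Fpow_def)
  show "mon_up_closed (- mon_of ` {{} :: 'a set})" by (rule mon_up_closed_nonfaces[OF complex])
  show "Var ` X \<subseteq> monomial_ideal X (- mon_of ` {{}})"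
    using Var_in_nonface_ideal[OF complex] by (auto simp: nonface_ideal_def)
  fix m assume m: "Poly_Mapping.keys m \<subseteq> X" "m \<in> - mon_of ` {{} :: 'a set}"
  then obtain x where x: "x \<in> Poly_Mapping.keys m" by fastforce
  then have "mon_dvd (Poly_Mapping.single x 1) m" by (simp add: mon_dvd_single_iff in_keys_iff)
  then show "\<exists>n. mon_dvd n m \<and> mon_poly n \<in> Var ` X" using x m(1) by (auto simp: Var_def)
qed

lemma square_notin_mon_of_image:
  assumes "simplicial_complex X \<Delta>"
  shows "Poly_Mapping.single x 2 \<notin> mon_of ` \<Delta>"
proof
  assume "Poly_Mapping.single x 2 \<in> mon_of ` \<Delta>"
  then obtain \<sigma> where \<sigma>: "\<sigma> \<in> \<Delta>" "mon_of \<sigma> = Poly_Mapping.single x 2" by (metis imageE)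
  have "Poly_Mapping.lookup (mon_of \<sigma>) x \<noteq> 2"
    using simplicial_complex_face_finite[OF assms \<sigma>(1)] by (simp add: lookup_mon_of)
  then show False by (simp add: \<sigma>(2))
qed

lemma nonface_divisible_by_generator:
  assumes "Poly_Mapping.keys m \<subseteq> X" "m \<notin> mon_of ` complex_avoiding X G"
  shows "(\<exists>x\<in>X. mon_dvd (Poly_Mapping.single x 2) m) \<or> (\<exists>g\<in>G. mon_dvd (mon_of g) m)"
proof (cases "\<exists>x. mon_dvd (Poly_Mapping.single x 2) m")
  case True
  then obtain x where x: "mon_dvd (Poly_Mapping.single x 2) m" by blast
  then have "x \<in> X" using assms(1) by (auto simp: mon_dvd_single_iff in_keys_iff)
  then show ?thesis using x by blast
next
  case False
  then have squarefree: "mon_of (Poly_Mapping.keys m) = m"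
    using mon_of_keys_or_square_dvd[of m] by blast
  have "Poly_Mapping.keys m \<notin> complex_avoiding X G" using assms(2) squarefree by (metis imageI)
  then obtain g where g: "g \<in> G" "g \<subseteq> Poly_Mapping.keys m"
    using assms(1) by (auto simp: complex_avoiding_def Fpow_def)
  then have "mon_dvd (mon_of g) (mon_of (Poly_Mapping.keys m))"
    using mon_dvd_mon_of_iff[OF finite_keys, of g m] finite_subset[OF g(2) finite_keys] by simp
  then show ?thesis using g(1) squarefree by auto
qed

lemma genideal_squares_prods:
  assumes "G \<subseteq> Fpow X"
  shows "Idl\<^bsub>int_poly_ring X\<^esub> ((\<lambda>x. (Var x)\<^sup>2) ` X \<union> (\<lambda>g. \<Prod>x\<in>g. Var x) ` G)
    = nonface_ideal X (complex_avoiding X G)" (is "Idl\<^bsub>_\<^esub> ?S = nonface_ideal X ?\<Delta>")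
  unfolding nonface_ideal_def
proof (rule genideal_eq_monomial_ideal)
  note complex = simplicial_complex_avoiding[of X G]
  show "mon_up_closed (- mon_of ` ?\<Delta>)" by (rule mon_up_closed_nonfaces[OF complex])
  have square: "(Var x)\<^sup>2 = mon_poly (Poly_Mapping.single x 2)" for x :: 'a
    by (simp add: power2_eq_square Var_def numeral_2_eq_2 flip: mon_poly_add single_add)
  have prod: "(\<Prod>x\<in>g. Var x) = mon_poly (mon_of g)" if "g \<in> G" for g
    using that assms by (intro prod_Var) (auto simp: Fpow_def)
  have "(Var x)\<^sup>2 \<in> nonface_ideal X ?\<Delta>" if "x \<in> X" for x
    using that square_notin_mon_of_image[OF complex] by (simp add: square nonface_ideal_def)
  moreover have "(\<Prod>x\<in>g. Var x) \<in> nonface_ideal X ?\<Delta>" if "g \<in> G" for g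
  proof -
    have "g \<subseteq> X" "finite g" "g \<notin> ?\<Delta>"
      using that assms by (auto simp: complex_avoiding_def Fpow_def)
    then show ?thesis by (simp add: prod[OF that] mon_poly_mon_of_in_nonface_ideal[OF complex])
  qed
  ultimately show "?S \<subseteq> monomial_ideal X (- mon_of ` ?\<Delta>)" by (auto simp: nonface_ideal_def)
  fix m assume "Poly_Mapping.keys m \<subseteq> X" "m \<in> - mon_of ` ?\<Delta>"
  then have "(\<exists>x\<in>X. mon_dvd (Poly_Mapping.single x 2) m) \<or> (\<exists>g\<in>G. mon_dvd (mon_of g) m)"
    by (intro nonface_divisible_by_generator) simp_all
  then show "\<exists>n. mon_dvd n m \<and> mon_poly n \<in> ?S" by (metis UnI1 UnI2 imageI square prod)
qed

section \<open>Resolutions\<close>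

lemma colon_seq_Nil: "I \<subseteq> carrier (int_poly_ring X) \<Longrightarrow> colon_seq X I [] = I"
  by (auto simp: colon_seq_def colon_def)

lemma colon_seq_snoc:
  "a \<in> X \<Longrightarrow> colon_seq X I (as @ [a]) = colon X (colon_seq X I as) (Var a)"
  using int_poly_ring_mult_closed[of "Var a" X] by (auto simp: colon_seq_def colon_def mult.assoc)

lemma resolution_snoc:
  "resolution X I (as @ [a]) \<longleftrightarrow> resolution X I as \<and> a \<in> X \<and> Var a \<notin> colon_seq X I as \<and>
    (is_cone X (colon_seq X I as) a \<or> (\<exists>b\<in>X. dominates X (colon_seq X I as) a b))"
  by (auto simp: resolution_def nth_append less_Suc_eq)

lemma resolution_iterated_suspension_link:
  assumes "iterated_suspension \<Delta> d" "simplicial_complex X \<Delta>" "a \<in> X" "Var a \<notin> nonface_ideal X \<Delta>"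
    "is_cone X (nonface_ideal X \<Delta>) a \<or> (\<exists>b\<in>X. dominates X (nonface_ideal X \<Delta>) a b)"
  obtains e where "d = Suc e" "iterated_suspension (link \<Delta> a) e"
proof -
  have "{a} \<in> \<Delta>" using assms(4) Var_in_nonface_ideal[OF assms(2,3)] by blast
  moreover obtain b where "weakly_dominates \<Delta> a b"
    using assms(5) is_cone_nonface_ideal[OF assms(2,3)] dominates_nonface_ideal[OF assms(2,3)]
      iterated_suspension_not_cone[OF assms(1,2)] by blast
  ultimately show thesis using iterated_suspension_link[OF assms(1,2)] that by blast
qed

lemma resolution_core_iterated_suspension:
  assumes "iterated_suspension \<Delta> d" "simplicial_complex X \<Delta>" "resolution X (nonface_ideal X \<Delta>) as"
  shows "\<exists>\<Gamma> e. colon_seq X (nonface_ideal X \<Delta>) as = nonface_ideal X \<Gamma> \<and>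
    simplicial_complex X \<Gamma> \<and> iterated_suspension \<Gamma> e \<and> d = length as + e"
  using assms(3)
proof (induction as rule: rev_induct)
  case Nil
  then show ?case using assms(1,2) by (auto simp: colon_seq_Nil nonface_ideal_carrier)
next
  case (snoc a as)
  then obtain \<Gamma> e where \<Gamma>: "colon_seq X (nonface_ideal X \<Delta>) as = nonface_ideal X \<Gamma>"
    "simplicial_complex X \<Gamma>" "iterated_suspension \<Gamma> e" "d = length as + e"
    by (auto simp: resolution_snoc)
  note extension = snoc.prems[unfolded resolution_snoc \<Gamma>(1)]
  then obtain e' where "e = Suc e'" "iterated_suspension (link \<Gamma> a) e'"
    using resolution_iterated_suspension_link[OF \<Gamma>(3,2)] by metis
  moreover have "colon_seq X (nonface_ideal X \<Delta>) (as @ [a]) = nonface_ideal X (link \<Gamma> a)"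
    using extension by (simp add: colon_seq_snoc \<Gamma>(1,2) colon_nonface_ideal)
  moreover have "simplicial_complex X (link \<Gamma> a)" by (rule simplicial_complex_link[OF \<Gamma>(2)])
  ultimately show ?case
    using \<Gamma>(4) by (intro exI[of _ "link \<Gamma> a"] exI[of _ e']) simp
qed

lemma iterated_suspension_resolution_extend:
  assumes "iterated_suspension \<Delta> d" "simplicial_complex X \<Delta>" "resolution X (nonface_ideal X \<Delta>) as"
    "length as < d"
  shows "\<exists>a. resolution X (nonface_ideal X \<Delta>) (as @ [a])"
proof -
  obtain \<Gamma> e where \<Gamma>: "colon_seq X (nonface_ideal X \<Delta>) as = nonface_ideal X \<Gamma>"
    "simplicial_complex X \<Gamma>" "iterated_suspension \<Gamma> e" "d = length as + e"
    using resolution_core_iterated_suspension[OF assms(1-3)] by blast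
  from \<Gamma>(3) show ?thesis
  proof cases
    case empty
    then show ?thesis using \<Gamma>(4) assms(4) by simp
  next
    case (suspend a b e')
    then have a: "{a} \<in> \<Gamma>" "weakly_dominates \<Gamma> a b" by (auto simp: poles_def)
    have b: "{b} \<in> \<Gamma>" by (rule poles_vertex[OF \<Gamma>(2) suspend(2)])
    have X: "a \<in> X" "b \<in> X" using simplicial_complex_face_ground[OF \<Gamma>(2)] a(1) b by blast+
    have "dominates X (nonface_ideal X \<Gamma>) a b"
      using dominates_nonface_ideal[OF \<Gamma>(2) X] a(2) iterated_suspension_not_cone[OF \<Gamma>(3,2)] by simp
    moreover have "Var a \<notin> nonface_ideal X \<Gamma>" using Var_in_nonface_ideal[OF \<Gamma>(2) X(1)] a(1) by simp
    ultimately show ?thesis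
      using assms(3) X unfolding resolution_snoc \<Gamma>(1) by blast
  qed
qed

lemma iterated_suspension_resolution_exists:
  assumes "iterated_suspension \<Delta> d" "simplicial_complex X \<Delta>" "n \<le> d"
  shows "\<exists>as. resolution X (nonface_ideal X \<Delta>) as \<and> length as = n"
  using assms(3)
proof (induction n)
  case 0
  then show ?case by (auto simp: resolution_def)
next
  case (Suc n)
  then obtain as where as: "resolution X (nonface_ideal X \<Delta>) as" "length as = n" by auto
  then obtain a where "resolution X (nonface_ideal X \<Delta>) (as @ [a])"
    using iterated_suspension_resolution_extend[OF assms(1,2) as(1)] Suc.prems by auto
  then show ?case using as(2) by (metis length_append_singleton)
qed

lemma maximal_resolution_iff:
  assumes "iterated_suspension \<Delta> d" "simplicial_complex X \<Delta>"
  shows "maximal_resolution X (nonface_ideal X \<Delta>) as \<longleftrightarrow>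
    resolution X (nonface_ideal X \<Delta>) as \<and> length as = d"
proof -
  have length: "length bs \<le> d" if "resolution X (nonface_ideal X \<Delta>) bs" for bs
    using resolution_core_iterated_suspension[OF assms that] by auto
  have "\<not> resolution X (nonface_ideal X \<Delta>) (as @ [a])" if "length as = d" for a
    using length[of "as @ [a]"] that by auto
  then show ?thesis
    using length[of as] iterated_suspension_resolution_extend[OF assms, of as]
    by (auto simp: maximal_resolution_def le_less)
qed

lemma iterated_suspension_simple_ideal:
  assumes "iterated_suspension \<Delta> d" "simplicial_complex X \<Delta>"
  shows "simple_ideal X (nonface_ideal X \<Delta>)"
proof -
  obtain as where as: "resolution X (nonface_ideal X \<Delta>) as" "length as = d"
    using iterated_suspension_resolution_exists[OF assms order_refl] by blast
  obtain \<Gamma> e where "colon_seq X (nonface_ideal X \<Delta>) as = nonface_ideal X \<Gamma>"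
    "iterated_suspension \<Gamma> e" "d = length as + e"
    using resolution_core_iterated_suspension[OF assms as(1)] by blast
  then have "colon_seq X (nonface_ideal X \<Delta>) as = nonface_ideal X {{}}"
    using as(2) by (simp add: iterated_suspension_0_iff)
  then show ?thesis
    using as maximal_resolution_iff[OF assms] unfolding simple_ideal_def genideal_Var by blast
qed

lemma iterated_suspension_resolution_depth:
  assumes "iterated_suspension \<Delta> d" "simplicial_complex X \<Delta>"
  shows "resolution_depth X (nonface_ideal X \<Delta>) = d"
  unfolding resolution_depth_def maximal_resolution_iff[OF assms]
  using iterated_suspension_resolution_exists[OF assms order_refl] by (intro Least_equality) auto

section \<open>Collapses of monomial complexes\<close>

lemma elementary_collapse_mon_of:
  assumes "face_collapse \<Delta> \<Delta>'" "\<And>\<sigma>. \<sigma> \<in> \<Delta> \<Longrightarrow> finite \<sigma>"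
  shows "elementary_collapse (mon_of ` \<Delta>) (mon_of ` \<Delta>')"
proof -
  obtain \<tau> x where \<tau>: "x \<notin> \<tau>" "\<tau> \<in> \<Delta>" "insert x \<tau> \<in> \<Delta>"
    "\<And>\<rho>. \<rho> \<in> \<Delta> \<Longrightarrow> \<tau> \<subseteq> \<rho> \<Longrightarrow> \<rho> = \<tau> \<or> \<rho> = insert x \<tau>" "\<Delta>' = \<Delta> - {\<tau>, insert x \<tau>}"
    using assms(1) unfolding face_collapse_def by blast
  have dvd_imp_subset: "\<upsilon> \<subseteq> \<rho>" if "mon_dvd (mon_of \<upsilon>) (mon_of \<rho>)" "\<upsilon> \<in> \<Delta>" "\<rho> \<in> \<Delta>" for \<upsilon> \<rho>
    using that assms(2) by (simp add: mon_dvd_mon_of_iff)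
  have "inj_on mon_of \<Delta>" using assms(2) by (auto simp: inj_on_def mon_of_inject)
  from inj_on_image_set_diff[OF this, of \<Delta> "{\<tau>, insert x \<tau>}"]
  have image: "mon_of ` \<Delta>' = mon_of ` \<Delta> - {mon_of (insert x \<tau>), mon_of \<tau>}"
    using \<tau> by (simp add: insert_commute)
  have maximal: "\<rho> = mon_of (insert x \<tau>)"
    if "\<rho> \<in> mon_of ` \<Delta>" "mon_dvd (mon_of (insert x \<tau>)) \<rho>" for \<rho>
    using that \<tau>(1,3,4) dvd_imp_subset by fastforce
  have free: "\<rho> = mon_of (insert x \<tau>)"
    if "\<rho> \<in> mon_of ` \<Delta>" "mon_dvd (mon_of \<tau>) \<rho> \<and> \<rho> \<noteq> mon_of \<tau>" for \<rho>
    using that \<tau>(2,4) dvd_imp_subset by fastforce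
  have "finite \<tau>" by (rule assms(2)[OF \<tau>(2)])
  then have "mon_dvd (mon_of \<tau>) (mon_of (insert x \<tau>))"
    "mon_degree (mon_of (insert x \<tau>)) = mon_degree (mon_of \<tau>) + 1"
    using \<tau>(1) by (auto simp: mon_dvd_mon_of_iff mon_degree_mon_of)
  then show ?thesis
    unfolding elementary_collapse_def using maximal free image
    by (intro bexI[of _ "mon_of (insert x \<tau>)"] bexI[of _ "mon_of \<tau>"] conjI ballI impI imageI \<tau>(2,3))
qed

lemma collapses_onto_mon_of:
  assumes "face_collapse\<^sup>*\<^sup>* \<Delta> \<Delta>'" "\<And>\<sigma>. \<sigma> \<in> \<Delta> \<Longrightarrow> finite \<sigma>"
  shows "collapses_onto (mon_of ` \<Delta>) (mon_of ` \<Delta>')"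
  using assms(1)
proof (induction rule: rtranclp_induct)
  case base
  then show ?case by (simp add: collapses_onto_def)
next
  case (step \<Gamma> \<Gamma>')
  have "elementary_collapse (mon_of ` \<Gamma>) (mon_of ` \<Gamma>')"
    using elementary_collapse_mon_of[OF step.hyps(2)] face_collapses_subset[OF step.hyps(1)]
      assms(2) by blast
  then show ?case using step.IH by (simp add: collapses_onto_def)
qed

lemma complex_vertices_mon_of:
  assumes "simplicial_complex X \<Delta>"
  shows "complex_vertices (mon_of ` \<Delta>) = \<Union>\<Delta>"
proof -
  have "complex_vertices (mon_of ` \<Delta>) = {x. {x} \<in> \<Delta>}"
    using mon_of_image_iff[OF assms, of "{x}" for x] by (simp add: complex_vertices_def)
  then show ?thesis using simplicial_complex_face_subset[OF assms] by auto
qed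

lemma rename_mon_mon_of:
  "finite \<sigma> \<Longrightarrow> inj_on f \<sigma> \<Longrightarrow> rename_mon f (mon_of \<sigma>) = mon_of (f ` \<sigma>)"
  by (simp add: rename_mon_def lookup_mon_of mon_of_def[of "f ` \<sigma>"] sum.reindex)

lemma complex_iso_image:
  assumes "simplicial_complex X \<Delta>" "inj_on f X"
  shows "complex_iso (mon_of ` \<Delta>) (mon_of ` (`) f ` \<Delta>)"
  unfolding complex_iso_def
proof (intro exI conjI)
  have sub: "\<sigma> \<subseteq> X" if "\<sigma> \<in> \<Delta>" for \<sigma>
    using that by (rule simplicial_complex_face_ground[OF assms(1)])
  then have "inj_on f (\<Union>\<Delta>)" using assms(2) by (meson Sup_least inj_on_subset)
  then show "bij_betw f (complex_vertices (mon_of ` \<Delta>)) (complex_vertices (mon_of ` (`) f ` \<Delta>))"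
    using complex_vertices_mon_of[OF assms(1)]
      complex_vertices_mon_of[OF simplicial_complex_image[OF assms(1)], of f]
    by (simp add: inj_on_imp_bij_betw flip: image_Union)
  have "rename_mon f (mon_of \<sigma>) = mon_of (f ` \<sigma>)" if "\<sigma> \<in> \<Delta>" for \<sigma>
    using that simplicial_complex_face_finite[OF assms(1)] inj_on_subset[OF assms(2) sub]
    by (simp add: rename_mon_mon_of)
  then show "rename_mon f ` mon_of ` \<Delta> = mon_of ` (`) f ` \<Delta>"
    unfolding image_image by (rule image_cong[OF refl])
qed

lemma cross_polytope_boundary_eq: "cross_polytope_boundary d = mon_of ` cross_faces d"
proof -
  let ?X = "{1..2*d}"
  have "(\<lambda>i. Var (2*i - 1) * Var (2*i)) ` {1..d} = (\<lambda>g. \<Prod>x\<in>g. Var x) ` cross_pairs d"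
    unfolding cross_pairs_def image_image by (rule image_cong) auto
  moreover have "cross_pairs d \<subseteq> Fpow ?X"
    using cross_pairs_ground[of d] finite_subset[of _ ?X] by (auto simp: Fpow_def)
  ultimately have "cross_polytope_boundary d = complex_of ?X (nonface_ideal ?X (cross_faces d))"
    using genideal_squares_prods[of "cross_pairs d" ?X]
    by (simp add: cross_polytope_boundary_def cross_faces_def Un_commute)
  also have "\<dots> = mon_of ` cross_faces d"
    by (rule complex_of_nonface_ideal[OF simplicial_complex_cross_faces])
  finally show ?thesis .
qed

lemma complex_iso_cross_polytope_boundary:
  assumes "inj_on g {1..2*d}"
  shows "complex_iso (mon_of ` (`) g ` cross_faces d) (cross_polytope_boundary d)"
proof -
  let ?f = "inv_into {1..2*d} g"
  have "?f ` g ` \<sigma> = \<sigma>" if "\<sigma> \<in> cross_faces d" for \<sigma>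
    using inv_into_image_cancel[OF assms]
      simplicial_complex_face_ground[OF simplicial_complex_cross_faces that] .
  then have "(`) ?f ` (`) g ` cross_faces d = cross_faces d" by (simp add: image_image)
  then show ?thesis
    using complex_iso_image[OF simplicial_complex_image[OF simplicial_complex_cross_faces, of g d]
        inj_on_inv_into[OF order_refl]]
    by (simp add: cross_polytope_boundary_eq)
qed

lemma iterated_suspension_collapses_onto_cross_polytope:
  assumes "iterated_suspension \<Delta> d" "simplicial_complex X \<Delta>" "finite X"
  shows "\<exists>K. collapses_onto (complex_of X (nonface_ideal X \<Delta>)) K \<and>
    complex_iso K (cross_polytope_boundary d)"
proof -
  obtain g where g: "inj_on g {1..2*d}" "face_collapse\<^sup>*\<^sup>* \<Delta> ((`) g ` cross_faces d)"
    using iterated_suspension_collapses[OF assms(1,2) finite_simplicial_complex[OF assms(2,3)]]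
    by blast
  have "collapses_onto (complex_of X (nonface_ideal X \<Delta>)) (mon_of ` (`) g ` cross_faces d)"
    unfolding complex_of_nonface_ideal[OF assms(2)]
    by (rule collapses_onto_mon_of[OF g(2) simplicial_complex_face_finite[OF assms(2)]])
  then show ?thesis using complex_iso_cross_polytope_boundary[OF g(1)] by blast
qed

section \<open>Leaves of forests\<close>

definition leaf :: "'a set set \<Rightarrow> 'a \<Rightarrow> 'a \<Rightarrow> bool" where
  "leaf E l p \<longleftrightarrow> {l, p} \<in> E \<and> (\<forall>u. {u, l} \<in> E \<longrightarrow> u = p)"

definition edges_avoiding :: "'a set set \<Rightarrow> 'a \<Rightarrow> 'a set set" where
  "edges_avoiding E p = {e \<in> E. p \<notin> e}"

lemma simple_graph_edgeD:
  assumes "simple_graph V E" "{u, v} \<in> E"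
  shows "u \<in> V" "v \<in> V" "u \<noteq> v"
  using assms by (auto simp: simple_graph_def)

lemma simple_graph_edgeE:
  assumes "simple_graph V E" "e \<in> E"
  obtains u v where "e = {u, v}"
  using assms unfolding simple_graph_def card_2_iff by metis

lemma finite_edges:
  assumes "simple_graph V E"
  shows "finite E"
proof (rule finite_subset)
  show "E \<subseteq> Pow V" "finite (Pow V)" using assms by (auto simp: simple_graph_def)
qed

lemma edges_avoiding_subset: "edges_avoiding E p \<subseteq> E"
  by (auto simp: edges_avoiding_def)

lemma simple_graph_edges_avoiding: "simple_graph V E \<Longrightarrow> simple_graph V (edges_avoiding E p)"
  by (simp add: simple_graph_def edges_avoiding_def)

lemma forest_edges_avoiding: "forest V E \<Longrightarrow> forest V (edges_avoiding E p)"
  by (fastforce simp: forest_def simple_graph_def graph_cycle_def edges_avoiding_def)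

lemma leaf_vertices:
  assumes "simple_graph V E" "leaf E l p"
  shows "l \<in> V" "p \<in> V" "l \<noteq> p"
  using assms(2) simple_graph_edgeD[OF assms(1)] by (auto simp: leaf_def)

lemma leaf_edge_iff:
  assumes "leaf E l p"
  shows "{u, l} \<in> E \<longleftrightarrow> u = p" "{l, u} \<in> E \<longleftrightarrow> u = p"
  using assms insert_commute[of l _ "{}"] unfolding leaf_def by metis+

lemma leaf_notin_edge:
  assumes "simple_graph V E" "leaf E l p" "e \<in> E" "p \<notin> e"
  shows "l \<notin> e"
proof
  assume "l \<in> e"
  obtain u v where "e = {u, v}" using simple_graph_edgeE[OF assms(1,3)] .
  with \<open>l \<in> e\<close> obtain w where "e = {w, l}" by blast
  then show False using leaf_edge_iff(1)[OF assms(2)] assms(3,4) by simp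
qed

lemma graph_cycle_path_chord:
  assumes "distinct xs" "successively (\<lambda>u v. {u, v} \<in> E) xs"
    "i < length xs" "2 \<le> i" "{xs ! i, xs ! 0} \<in> E"
  shows "graph_cycle E (take (Suc i) xs)"
  unfolding graph_cycle_def
proof (intro conjI allI impI)
  let ?c = "take (Suc i) xs"
  show "3 \<le> length ?c" "distinct ?c" using assms by simp_all
  fix k assume "k < length ?c"
  then consider (path) "k < i" | (chord) "k = i" using assms(3) by fastforce
  then show "{?c ! k, ?c ! (Suc k mod length ?c)} \<in> E"
  proof cases
    case path
    then show ?thesis using assms(2,3) by (simp add: successively_conv_nth)
  next
    case chord
    then show ?thesis using assms(3,5) by simp
  qed
qed

text \<open>An endpoint of a longest path is a leaf: a further neighbour would either prolong the path
  or close a cycle.\<close>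

lemma forest_leaf_exists:
  assumes "forest V E" "E \<noteq> {}"
  obtains l p where "leaf E l p"
proof -
  have graph: "simple_graph V E" and acyclic: "\<And>vs. \<not> graph_cycle E vs"
    using assms(1) by (auto simp: forest_def)
  define path where
    "path xs \<longleftrightarrow> distinct xs \<and> set xs \<subseteq> V \<and> successively (\<lambda>u v. {u, v} \<in> E) xs" for xs
  obtain u v where uv: "{u, v} \<in> E"
    using assms(2) simple_graph_edgeE[OF graph] by (metis ex_in_conv)
  then have path_uv: "path [u, v]" using simple_graph_edgeD[OF graph uv] by (simp add: path_def)
  have "length xs < Suc (card V)" if "path xs" for xs
    using that graph card_mono[of V "set xs"]
    by (simp add: path_def distinct_card simple_graph_def less_Suc_eq_le)
  then obtain xs where xs: "path xs" and longest: "\<And>ys. path ys \<Longrightarrow> length ys \<le> length xs"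
    using ex_has_greatest_nat[of path "[u, v]" length "Suc (card V)"] path_uv by blast
  have "2 \<le> length xs" using longest[OF path_uv] by simp
  then obtain l p ys where xs_eq: "xs = l # p # ys" by (auto simp: Suc_le_length_iff numeral_2_eq_2)
  have "w = p" if w: "{w, l} \<in> E" for w
  proof -
    have "w \<in> set xs"
    proof (rule ccontr)
      assume "w \<notin> set xs"
      then have "path (w # xs)"
        using xs w simple_graph_edgeD(1)[OF graph w] by (simp add: path_def xs_eq)
      then show False using longest by fastforce
    qed
    then obtain i where i: "i < length xs" "xs ! i = w" by (auto simp: in_set_conv_nth)
    have "\<not> 2 \<le> i"
      using graph_cycle_path_chord[of xs E i] xs i w acyclic by (auto simp: path_def xs_eq)
    moreover have "i \<noteq> 0"
      using i(2) simple_graph_edgeD(3)[OF graph w] by (cases i) (auto simp: xs_eq)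
    ultimately have "i = 1" by simp
    then show "w = p" using i(2) by (simp add: xs_eq)
  qed
  moreover have "{l, p} \<in> E" using xs by (simp add: path_def xs_eq)
  ultimately have "leaf E l p" by (simp add: leaf_def)
  then show thesis by (rule that)
qed

lemma forest_induct [consumes 1, case_names empty leaf]:
  assumes "forest V E" "P {}"
    "\<And>E l p. forest V E \<Longrightarrow> leaf E l p \<Longrightarrow> P (edges_avoiding E p) \<Longrightarrow> P E"
  shows "P E"
proof -
  have "finite E" using assms(1) finite_edges by (auto simp: forest_def)
  then show ?thesis using assms(1)
  proof (induction E rule: finite_psubset_induct)
    case (psubset E)
    show ?case
    proof (cases "E = {}")
      case False
      then obtain l p where leaf: "leaf E l p" using forest_leaf_exists psubset.prems by metis
      then have "edges_avoiding E p \<subset> E" by (auto simp: leaf_def edges_avoiding_def)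
      then show ?thesis
        using assms(3)[OF psubset.prems leaf] psubset.IH forest_edges_avoiding[OF psubset.prems]
        by blast
    qed (simp add: assms(2))
  qed
qed

section \<open>Matchings and vertex covers\<close>

definition matching :: "'a set set \<Rightarrow> 'a set set \<Rightarrow> bool" where
  "matching E M \<longleftrightarrow> M \<subseteq> E \<and> disjoint M"

definition vertex_cover :: "'a set \<Rightarrow> 'a set set \<Rightarrow> 'a set \<Rightarrow> bool" where
  "vertex_cover V E C \<longleftrightarrow> C \<subseteq> V \<and> (\<forall>e\<in>E. e \<inter> C \<noteq> {})"

lemma card_matching_le: "finite E \<Longrightarrow> matching E M \<Longrightarrow> card M \<le> matching_number E"
  unfolding matching_number_def matching_def by (intro Max_ge) auto

lemma maximum_matching_exists:
  assumes "finite E"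
  obtains M where "matching E M" "card M = matching_number E"
proof -
  have "{} \<in> {M. M \<subseteq> E \<and> disjoint M}" by simp
  then have "matching_number E \<in> card ` {M. M \<subseteq> E \<and> disjoint M}"
    unfolding matching_number_def using assms by (intro Max_in) auto
  then show thesis using that by (auto simp: matching_def)
qed

lemma vertex_cover_number_le: "finite V \<Longrightarrow> vertex_cover V E C \<Longrightarrow> vertex_cover_number V E \<le> card C"
  unfolding vertex_cover_number_def vertex_cover_def by (intro Min_le) auto

lemma minimum_vertex_cover_exists:
  assumes "simple_graph V E"
  obtains C where "vertex_cover V E C" "card C = vertex_cover_number V E"
proof -
  have "e \<inter> V \<noteq> {}" if "e \<in> E" for e
    using that assms unfolding simple_graph_def by (metis card.empty inf.absorb1 zero_neq_numeral)
  then have "V \<in> {C. C \<subseteq> V \<and> (\<forall>e\<in>E. e \<inter> C \<noteq> {})}" by blast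
  moreover have "finite V" using assms by (simp add: simple_graph_def)
  ultimately have "vertex_cover_number V E \<in> card ` {C. C \<subseteq> V \<and> (\<forall>e\<in>E. e \<inter> C \<noteq> {})}"
    unfolding vertex_cover_number_def by (intro Min_in) auto
  then show thesis using that by (auto simp: vertex_cover_def)
qed

lemma matching_number_le_Suc_edges_avoiding:
  assumes "finite E"
  shows "matching_number E \<le> Suc (matching_number (edges_avoiding E p))"
proof -
  obtain M where M: "matching E M" "card M = matching_number E"
    using maximum_matching_exists[OF assms] .
  let ?M\<^sub>p = "{e \<in> M. p \<in> e}"
  have "finite M" using M(1) assms by (auto simp: matching_def intro: finite_subset)
  have "e = e'" if "e \<in> ?M\<^sub>p" "e' \<in> ?M\<^sub>p" for e e'
  proof (rule ccontr)
    assume "e \<noteq> e'"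
    then have "e \<inter> e' = {}" using that M(1) by (simp add: matching_def disjoint_def)
    then show False using that by blast
  qed
  then have "card ?M\<^sub>p \<le> Suc 0" using \<open>finite M\<close> by (simp add: card_le_Suc0_iff_eq)
  moreover have "matching (edges_avoiding E p) (M - ?M\<^sub>p)"
    using M(1) by (auto simp: matching_def disjoint_def edges_avoiding_def)
  then have "card (M - ?M\<^sub>p) \<le> matching_number (edges_avoiding E p)"
    by (rule card_matching_le[OF finite_subset[OF edges_avoiding_subset assms]])
  moreover have "card M = card ?M\<^sub>p + card (M - ?M\<^sub>p)"
    using \<open>finite M\<close> card_Diff_subset[of ?M\<^sub>p M] card_mono[of M ?M\<^sub>p] by simp
  ultimately show ?thesis using M(2) by simp
qed

lemma matching_number_leaf:
  assumes "simple_graph V E" "leaf E l p"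
  shows "matching_number E = Suc (matching_number (edges_avoiding E p))"
proof (rule antisym)
  let ?E = "edges_avoiding E p"
  have "finite E" by (rule finite_edges[OF assms(1)])
  then show "matching_number E \<le> Suc (matching_number ?E)"
    by (rule matching_number_le_Suc_edges_avoiding)
  have "finite ?E" by (rule finite_edges[OF simple_graph_edges_avoiding[OF assms(1)]])
  then obtain M where M: "matching ?E M" "card M = matching_number ?E"
    by (rule maximum_matching_exists)
  have "e \<inter> {l, p} = {}" if "e \<in> M" for e
    using that M(1) leaf_notin_edge[OF assms] by (auto simp: matching_def edges_avoiding_def)
  moreover have "{l, p} \<in> E" "M \<subseteq> E" "disjoint M"
    using assms(2) M(1) edges_avoiding_subset[of E p] by (auto simp: matching_def leaf_def)
  ultimately have "matching E (insert {l, p} M)"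
    by (auto simp: matching_def disjoint_def Int_commute)
  then have "card (insert {l, p} M) \<le> matching_number E" by (rule card_matching_le[OF \<open>finite E\<close>])
  moreover have "{l, p} \<notin> M" using M(1) by (auto simp: matching_def edges_avoiding_def)
  moreover have "finite M" using \<open>M \<subseteq> E\<close> \<open>finite E\<close> by (rule finite_subset)
  ultimately show "Suc (matching_number ?E) \<le> matching_number E" using M(2) by simp
qed

lemma vertex_cover_number_leaf:
  assumes "simple_graph V E" "leaf E l p"
  shows "vertex_cover_number V E = Suc (vertex_cover_number V (edges_avoiding E p))"
proof (rule antisym)
  let ?E = "edges_avoiding E p"
  have fin: "finite V" using assms(1) by (simp add: simple_graph_def)
  obtain C where C: "vertex_cover V ?E C" "card C = vertex_cover_number V ?E"
    using minimum_vertex_cover_exists[OF simple_graph_edges_avoiding[OF assms(1)]] .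
  have "vertex_cover V E (insert p C)"
    using C(1) leaf_vertices(2)[OF assms] by (auto simp: vertex_cover_def edges_avoiding_def)
  then have "vertex_cover_number V E \<le> card (insert p C)" by (rule vertex_cover_number_le[OF fin])
  also have "\<dots> \<le> Suc (card C)" by (rule card_insert_le_m1) simp_all
  finally show "vertex_cover_number V E \<le> Suc (vertex_cover_number V ?E)" by (simp add: C(2))
  obtain D where D: "vertex_cover V E D" "card D = vertex_cover_number V E"
    using minimum_vertex_cover_exists[OF assms(1)] .
  have "finite D" using D(1) fin by (auto simp: vertex_cover_def intro: finite_subset)
  have "e \<inter> (D - {l, p}) \<noteq> {}" if "e \<in> ?E" for e
    using that D(1) leaf_notin_edge[OF assms, of e]
    by (auto simp: vertex_cover_def edges_avoiding_def)
  then have "vertex_cover V ?E (D - {l, p})" using D(1) by (auto simp: vertex_cover_def)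
  then have "vertex_cover_number V ?E \<le> card (D - {l, p})" by (rule vertex_cover_number_le[OF fin])
  also have "D - {l, p} \<subset> D" using D(1) assms(2) by (auto simp: vertex_cover_def leaf_def)
  then have "card (D - {l, p}) < card D" by (rule psubset_card_mono[OF \<open>finite D\<close>])
  finally show "Suc (vertex_cover_number V ?E) \<le> vertex_cover_number V E" by (simp add: D(2))
qed

lemma forest_matching_number_eq_vertex_cover_number:
  assumes "forest V E"
  shows "matching_number E = vertex_cover_number V E"
  using assms
proof (induction rule: forest_induct)
  case empty
  have "matching_number {} = 0" by (simp add: matching_number_def)
  moreover have "finite V" using assms by (simp add: forest_def simple_graph_def)
  then have "vertex_cover_number V {} = 0"
    using vertex_cover_number_le[of V "{}" "{}"] by (simp add: vertex_cover_def)
  ultimately show ?case by simp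
next
  case (leaf E l p)
  then have "simple_graph V E" by (simp add: forest_def)
  from matching_number_leaf[OF this leaf.hyps(2)] vertex_cover_number_leaf[OF this leaf.hyps(2)]
  show ?case using leaf.IH by simp
qed

section \<open>Dominance complexes\<close>

definition dominance_faces :: "'a set \<Rightarrow> 'a set set \<Rightarrow> 'a set set" where
  "dominance_faces V E = complex_avoiding V (closed_nbhd E ` V)"

lemma simplicial_complex_dominance_faces: "simplicial_complex V (dominance_faces V E)"
  unfolding dominance_faces_def by (rule simplicial_complex_avoiding)

lemma dominance_faces_iff:
  "\<sigma> \<in> dominance_faces V E \<longleftrightarrow> \<sigma> \<in> Fpow V \<and> (\<forall>v\<in>V. \<not> closed_nbhd E v \<subseteq> \<sigma>)"
  by (simp add: dominance_faces_def complex_avoiding_def)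

lemma star_ideal_eq_nonface_ideal:
  assumes "simple_graph V E"
  shows "star_ideal V E = nonface_ideal V (dominance_faces V E)"
proof -
  have "closed_nbhd E v \<in> Fpow V" if "v \<in> V" for v
  proof -
    have "closed_nbhd E v \<subseteq> V"
      using that simple_graph_edgeD(1)[OF assms] by (auto simp: closed_nbhd_def)
    then show ?thesis using assms by (auto simp: Fpow_def simple_graph_def intro: finite_subset)
  qed
  then have "closed_nbhd E ` V \<subseteq> Fpow V" by blast
  from genideal_squares_prods[OF this] show ?thesis
    by (simp add: star_ideal_def dominance_faces_def image_image)
qed

lemma dominance_faces_no_edges: "dominance_faces V {} = {{}}"
  by (fastforce simp: dominance_faces_iff closed_nbhd_def Fpow_def)

lemma closed_nbhd_self: "v \<in> closed_nbhd E v"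
  by (simp add: closed_nbhd_def)

lemma closed_nbhd_leaf: "leaf E l p \<Longrightarrow> closed_nbhd E l = {l, p}"
  by (auto simp: closed_nbhd_def leaf_edge_iff)

lemma leaf_in_closed_nbhd_iff: "leaf E l p \<Longrightarrow> l \<in> closed_nbhd E v \<longleftrightarrow> v = l \<or> v = p"
  by (auto simp: closed_nbhd_def leaf_edge_iff)

lemma support_in_closed_nbhd:
  assumes "leaf E l p" "l \<in> closed_nbhd E v"
  shows "p \<in> closed_nbhd E v"
  using assms(2) closed_nbhd_leaf[OF assms(1)] closed_nbhd_self[of p E]
  unfolding leaf_in_closed_nbhd_iff[OF assms(1)] by blast

lemma closed_nbhd_edges_avoiding:
  "closed_nbhd (edges_avoiding E p) v = (if v = p then {p} else closed_nbhd E v - {p})"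
  by (auto simp: closed_nbhd_def edges_avoiding_def)

text \<open>The generator \<open>N[p]\<close> becomes redundant because \<open>N[l] - {p} = {l}\<close>.\<close>

lemma link_dominance_faces:
  assumes "simple_graph V E" "leaf E l p"
  shows "link (dominance_faces V E) p = dominance_faces V (edges_avoiding E p)"
proof -
  note lp = leaf_vertices[OF assms]
  have redundant: "\<not> closed_nbhd E p - {p} \<subseteq> \<sigma>" if "\<not> closed_nbhd E l - {p} \<subseteq> \<sigma>" for \<sigma>
    using that lp(3) closed_nbhd_leaf[OF assms(2)] leaf_in_closed_nbhd_iff[OF assms(2), of p]
    by auto
  show ?thesis
  proof (rule Set.set_eqI)
    fix \<sigma>
    have "\<sigma> \<in> link (dominance_faces V E) p \<longleftrightarrow>
      \<sigma> \<in> Fpow V \<and> p \<notin> \<sigma> \<and> (\<forall>v\<in>V. \<not> closed_nbhd E v - {p} \<subseteq> \<sigma>)"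
      using lp(2) by (auto simp: link_def dominance_faces_iff Fpow_def subset_insert_iff)
    also have "\<dots> \<longleftrightarrow> \<sigma> \<in> Fpow V \<and> p \<notin> \<sigma> \<and> (\<forall>v\<in>V - {p}. \<not> closed_nbhd E v - {p} \<subseteq> \<sigma>)"
      using redundant[of \<sigma>] lp by blast
    also have "\<dots> \<longleftrightarrow> \<sigma> \<in> dominance_faces V (edges_avoiding E p)"
      using lp(2) by (auto simp: dominance_faces_iff closed_nbhd_edges_avoiding)
    finally show "\<sigma> \<in> link (dominance_faces V E) p \<longleftrightarrow> \<sigma> \<in> dominance_faces V (edges_avoiding E p)" .
  qed
qed

lemma poles_dominance_faces:
  assumes "simple_graph V E" "leaf E l p"
  shows "poles (dominance_faces V E) p l"
  unfolding poles_def
proof (intro conjI)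
  note lp = leaf_vertices[OF assms]
  have "\<not> closed_nbhd E v \<subseteq> {p}" for v
    using closed_nbhd_self[of v E] leaf_in_closed_nbhd_iff[OF assms(2), of v] lp(3) by blast
  then show "{p} \<in> dominance_faces V E" using lp(2) by (simp add: dominance_faces_iff Fpow_def)
  have "closed_nbhd E l \<subseteq> {p, l}" using closed_nbhd_leaf[OF assms(2)] by blast
  then show "{p, l} \<notin> dominance_faces V E" using lp(1) unfolding dominance_faces_iff by blast
  show "weakly_dominates (dominance_faces V E) p l"
  proof (rule weakly_dominatesI)
    show "p \<noteq> l" using lp(3) by simp
    fix \<sigma> assume \<sigma>: "\<sigma> \<in> dominance_faces V E" "p \<notin> \<sigma>"
    have "\<not> closed_nbhd E v \<subseteq> insert l \<sigma>" if "v \<in> V" for v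
      using that \<sigma> lp(3) support_in_closed_nbhd[OF assms(2), of v]
      unfolding dominance_faces_iff by blast
    then show "insert l \<sigma> \<in> dominance_faces V E"
      using \<sigma>(1) lp(1) by (simp add: dominance_faces_iff Fpow_def)
  qed
qed

lemma forest_iterated_suspension:
  "forest V E \<Longrightarrow> iterated_suspension (dominance_faces V E) (matching_number E)"
proof (induction rule: forest_induct)
  case empty
  then show ?case
    by (simp add: dominance_faces_no_edges matching_number_def iterated_suspension_0_iff)
next
  case (leaf E l p)
  then have graph: "simple_graph V E" by (simp add: forest_def)
  from iterated_suspension.suspend[OF poles_dominance_faces[OF graph leaf.hyps(2)]] show ?case
    using leaf.IH
    by (simp add: link_dominance_faces[OF graph leaf.hyps(2)]
          matching_number_leaf[OF graph leaf.hyps(2)])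
qed

theorem theorem8p1:
  fixes V :: "'a set" and E :: "'a set set"
  assumes "forest V E"
  shows "simple_ideal V (star_ideal V E) \<and>
    (\<exists>K. collapses_onto (complex_of V (star_ideal V E)) K \<and>
         complex_iso K (cross_polytope_boundary (resolution_depth V (star_ideal V E)))) \<and>
    matching_number E = vertex_cover_number V E \<and>
    vertex_cover_number V E = resolution_depth V (star_ideal V E)"
proof -
  have graph: "simple_graph V E" and "finite V"
    using assms by (auto simp: forest_def simple_graph_def)
  note suspension = forest_iterated_suspension[OF assms]
  note complex = simplicial_complex_dominance_faces[of V E]
  have depth: "resolution_depth V (nonface_ideal V (dominance_faces V E)) = matching_number E"
    by (rule iterated_suspension_resolution_depth[OF suspension complex])
  show ?thesis
    unfolding star_ideal_eq_nonface_ideal[OF graph] depth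
    using iterated_suspension_simple_ideal[OF suspension complex]
      iterated_suspension_collapses_onto_cross_polytope[OF suspension complex \<open>finite V\<close>]
      forest_matching_number_eq_vertex_cover_number[OF assms] by simp
qed

end
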